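(* Let $n,p,q\ge1$, let $x=(x_{ijk})\in\mathbb{C}^n\otimes\mathbb{C}^p\otimes\mathbb{C}^q$, let $X_2=\mathrm{tr}_2(xx^* )\in M_n\otimes M_q$, $X_3=\mathrm{tr}_3(xx^* )\in M_n\otimes M_p$, and for $i=1,\dots,n$ let $S_i=(x_{ijk})_{1\le j\le p,\,1\le k\le q}\in M_{p,q}$ and $R_i=S_i^t\in M_{q,p}$. Suppose that for every $i=1,\dots,n$ the matrix $R_i$ has rank one, $R_i=u_id_iv_i^t$ with $d_i>0$ and unit vectors $u_i\in\mathbb{C}^q$, $v_i\in\mathbb{C}^p$. Then the following conditions are equivalent. (a) There is a TPCP map $T:M_n\otimes M_q\to M_n\otimes M_p$ of the form $T(X)=\sum_{j=1}^r(I_n\otimes F_j)X(I_n\otimes F_j)^*$ with $F_1,\dots,F_r\in M_{p,q}$ (for some $r$), satisfying $T(X_2)=X_3$. (b) There is a TPCP map $L:M_q\to M_p$ with $L(R_uR_v^* )=S_uS_v^*$ for all $1\le u,v\le n$. (c) For some $r$ there are $p\times q$ matrices $F_1,\dots,F_r$ with $\sum_{j=1}^rF_j^*F_j=I_q$ and $1\times p$ matrices $W_{i1},\dots,W_{ir}$ ($i=1,\dots,n$) such that for all $i,j=1,\dots,n$, $[F_1R_i\ \cdots\ F_rR_i]=v_id_i[W_{i1}\ \cdots\ W_{ir}]$ and $[W_{i1}\ \cdots\ W_{ir}][W_{j1}\ \cdots\ W_{jr}]^*=u_i^t\,\overline{u_j}$. (d) For some $r$ (with $pr\ge q$) there are unit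 vectors $\gamma_1,\dots,\gamma_n\in\mathbb{C}^r$ and a unitary $U\in M_{pr}$ such that $$U[e_1\otimes u_1\ \cdots\ e_1\otimes u_n]=[\gamma_1\otimes v_1\ \cdots\ \gamma_n\otimes v_n],$$ where $e_1\otimes u_i$ denotes the vector in $\mathbb{C}^{pr}$ whose first $q$ entries are those of $u_i$ and whose remaining entries are zero. (e) There is a correlation matrix $C\in M_n$ such that $(u_i^*u_j)_{1\le i,j\le n}=(v_i^*v_j)_{1\le i,j\le n}\circ C$. (f) There exists a TPCP map $M_q\to M_p$ sending $u_iu_i^*$ to $v_iv_i^*$ for all $i=1,\dots,n$.
   Context: $M_{a,b}$ is the set of $a\times b$ complex matrices and $M_a=M_{a,a}$. $A^t$ is the transpose, $\overline{A}$ the entrywise conjugate, $A^*$ the conjugate transpose, and $\circ$ is the entrywise (Schur/Hadamard) product. A correlation matrix is a positive semidefinite matrix with all diagonal entries equal to $1$. The entries of $x$ are arranged in lexicographic order of $(ijk)$. $\mathrm{tr}_2,\mathrm{tr}_3$ denote the partial traces over the second and third tensor factor of $\mathbb{C}^n\otimes\mathbb{C}^p\otimes\mathbb{C}^q$: $X_2=\sum_{j=1}^p y_jy_j^*$ with $y_j=(x_{ijk})_{i,k}\in\mathbb{C}^n\otimes\mathbb{C}^q$, and $X_3=\sum_{k=1}^q z_kz_k^*$ with $z_k=(x_{ijk})_{i,j}\in\mathbb{C}^n\otimes\mathbb{C}^p$. A TPCP map is a trace-preserving completely positive linear map; equivalently, a map $M_a\to M_b$ of the form $Y\mapsto\sum_{j=1}^r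 G_jYG_j^*$ with $G_j\in M_{b,a}$ and $\sum_jG_j^*G_j=I_a$. *)

theory Defs
  imports "Jordan_Normal_Form.Schur_Decomposition" "Jordan_Normal_Form.DL_Rank"
begin

text \<open>All indices are counted from 0. Tensor products of coordinate spaces use the
  lexicographic order, so the space C^a (x) C^b is C^(a*b) and the basis vector with multi-index
  (i,j) sits at position i * b + j; likewise M_a (x) M_b is M_(a*b).\<close>

definition lex3 :: "nat \<Rightarrow> nat \<Rightarrow> nat \<Rightarrow> nat \<Rightarrow> nat \<Rightarrow> nat" where
  "lex3 p q i j k = (i * p + j) * q + k"

definition col_mat :: "complex vec \<Rightarrow> complex mat" where
  "col_mat v = mat (dim_vec v) 1 (\<lambda>(i, _). v $ i)"

definition unit_norm :: "nat \<Rightarrow> complex vec \<Rightarrow> bool" where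
  "unit_norm m v \<longleftrightarrow> v \<in> carrier_vec m \<and> conjugate v \<bullet> v = 1"

definition kron_vec :: "complex vec \<Rightarrow> complex vec \<Rightarrow> complex vec" where
  "kron_vec v w = vec (dim_vec v * dim_vec w) (\<lambda>i. v $ (i div dim_vec w) * w $ (i mod dim_vec w))"

definition kron_mat :: "complex mat \<Rightarrow> complex mat \<Rightarrow> complex mat" where
  "kron_mat A B = mat (dim_row A * dim_row B) (dim_col A * dim_col B)
     (\<lambda>(i, j). A $$ (i div dim_row B, j div dim_col B) * B $$ (i mod dim_row B, j mod dim_col B))"

definition schur_prod :: "complex mat \<Rightarrow> complex mat \<Rightarrow> complex mat" where
  "schur_prod A B = mat (dim_row A) (dim_col A) (\<lambda>ij. A $$ ij * B $$ ij)"

definition trace_mat :: "complex mat \<Rightarrow> complex" where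
  "trace_mat A = (\<Sum>i<dim_row A. A $$ (i, i))"

text \<open>\<open>sum_mats a b r G\<close> is the sum of the a by b matrices \<open>G 0, ..., G (r - 1)\<close>
  (matrices of type \<^typ>\<open>complex mat\<close> carry their size as data and form no additive monoid),
  and \<open>block_row a b r G\<close> is the a by (r * b) matrix \<open>[G 0 ... G (r - 1)]\<close>.\<close>

definition sum_mats :: "nat \<Rightarrow> nat \<Rightarrow> nat \<Rightarrow> (nat \<Rightarrow> complex mat) \<Rightarrow> complex mat" where
  "sum_mats a b r G = mat a b (\<lambda>ij. \<Sum>l<r. G l $$ ij)"

definition block_row :: "nat \<Rightarrow> nat \<Rightarrow> nat \<Rightarrow> (nat \<Rightarrow> complex mat) \<Rightarrow> complex mat" where
  "block_row a b r G = mat a (r * b) (\<lambda>(i, j). G (j div b) $$ (i, j mod b))"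

text \<open>The partial traces over the second and over the third factor of C^n (x) C^p (x) C^q.\<close>

definition ptrace2 :: "nat \<Rightarrow> nat \<Rightarrow> nat \<Rightarrow> complex mat \<Rightarrow> complex mat" where
  "ptrace2 n p q X = mat (n * q) (n * q) (\<lambda>(a, b).
     \<Sum>j<p. X $$ (lex3 p q (a div q) j (a mod q), lex3 p q (b div q) j (b mod q)))"

definition ptrace3 :: "nat \<Rightarrow> nat \<Rightarrow> nat \<Rightarrow> complex mat \<Rightarrow> complex mat" where
  "ptrace3 n p q X = mat (n * p) (n * p) (\<lambda>(a, b).
     \<Sum>k<q. X $$ (lex3 p q (a div p) (a mod p) k, lex3 p q (b div p) (b mod p) k))"

definition unitary_mat :: "nat \<Rightarrow> complex mat \<Rightarrow> bool" where
  "unitary_mat m U \<longleftrightarrow>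
     U \<in> carrier_mat m m \<and> mat_adjoint U * U = 1\<^sub>m m \<and> U * mat_adjoint U = 1\<^sub>m m"

text \<open>On complex numbers \<open>0 \<le> z\<close> says that z is real and nonnegative; requiring this of all
  numbers \<open>v\<^sup>* A v\<close> makes A Hermitian.\<close>

definition psd_mat :: "nat \<Rightarrow> complex mat \<Rightarrow> bool" where
  "psd_mat m A \<longleftrightarrow>
     A \<in> carrier_mat m m \<and> (\<forall>v\<in>carrier_vec m. 0 \<le> conjugate v \<bullet> (A *\<^sub>v v))"

definition correlation_mat :: "nat \<Rightarrow> complex mat \<Rightarrow> bool" where
  "correlation_mat m C \<longleftrightarrow> psd_mat m C \<and> (\<forall>i<m. C $$ (i, i) = 1)"

text \<open>Maps M_a -> M_b are functions on \<^typ>\<open>complex mat\<close> of which only the values on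
  \<open>carrier_mat a a\<close> matter.\<close>

definition linear_map_mat :: "nat \<Rightarrow> nat \<Rightarrow> (complex mat \<Rightarrow> complex mat) \<Rightarrow> bool" where
  "linear_map_mat a b T \<longleftrightarrow>
     (\<forall>X\<in>carrier_mat a a. T X \<in> carrier_mat b b) \<and>
     (\<forall>X\<in>carrier_mat a a. \<forall>Y\<in>carrier_mat a a. T (X + Y) = T X + T Y) \<and>
     (\<forall>c. \<forall>X\<in>carrier_mat a a. T (c \<cdot>\<^sub>m X) = c \<cdot>\<^sub>m T X)"

text \<open>\<open>ampliation k a b T\<close> is the map id (x) T from M_k (x) M_a to M_k (x) M_b: it applies T to
  each of the k * k blocks of size a by a.\<close>

definition block :: "nat \<Rightarrow> complex mat \<Rightarrow> nat \<Rightarrow> nat \<Rightarrow> complex mat" where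
  "block a X s t = mat a a (\<lambda>(i, j). X $$ (s * a + i, t * a + j))"

definition ampliation ::
  "nat \<Rightarrow> nat \<Rightarrow> nat \<Rightarrow> (complex mat \<Rightarrow> complex mat) \<Rightarrow> complex mat \<Rightarrow> complex mat" where
  "ampliation k a b T X = mat (k * b) (k * b)
     (\<lambda>(i, j). T (block a X (i div b) (j div b)) $$ (i mod b, j mod b))"

definition completely_positive :: "nat \<Rightarrow> nat \<Rightarrow> (complex mat \<Rightarrow> complex mat) \<Rightarrow> bool" where
  "completely_positive a b T \<longleftrightarrow>
     (\<forall>k X. psd_mat (k * a) X \<longrightarrow> psd_mat (k * b) (ampliation k a b T X))"

definition TPCP :: "nat \<Rightarrow> nat \<Rightarrow> (complex mat \<Rightarrow> complex mat) \<Rightarrow> bool" where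
  "TPCP a b T \<longleftrightarrow>
     linear_map_mat a b T \<and> completely_positive a b T \<and>
     (\<forall>X\<in>carrier_mat a a. trace_mat (T X) = trace_mat X)"

end

theory Submission
  imports Defs
begin

text \<open>Each condition is equivalent to the existence of Kraus operators \<open>F\<^sub>1, ..., F\<^sub>r\<close> with
  \<open>\<Sum> F\<^sub>l\<^sup>* F\<^sub>l = 1\<close> and scalars \<open>g\<^sub>i\<^sub>l\<close> with \<open>F\<^sub>l u\<^sub>i = g\<^sub>i\<^sub>l v\<^sub>i\<close>. For (b) and (f) the operators come from
  Choi's theorem, and for (a) from the given form of the map; they send \<open>u\<^sub>i\<close> to multiples of \<open>v\<^sub>i\<close>
  because \<open>\<Sum> (F\<^sub>l u\<^sub>i)(F\<^sub>l u\<^sub>i)\<^sup>* = v\<^sub>i v\<^sub>i\<^sup>*\<close> has rank one. Comparing inner products,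
  \<open>u\<^sub>i\<^sup>* u\<^sub>j = (\<Sum> cnj g\<^sub>i\<^sub>l g\<^sub>j\<^sub>l) v\<^sub>i\<^sup>* v\<^sub>j\<close>, so the Gram matrix of the \<open>g\<^sub>i\<close> is the correlation matrix of (e).
  Conversely a correlation matrix is a Gram matrix of unit vectors \<open>\<gamma>\<^sub>i\<close>; the families \<open>e\<^sub>1 \<otimes> u\<^sub>i\<close> and
  \<open>\<gamma>\<^sub>i \<otimes> v\<^sub>i\<close> then have equal inner products, so a product of reflections maps the one to the other,
  and the \<open>p \<times> q\<close> blocks of the first \<open>q\<close> columns of that unitary are Kraus operators.\<close>

subsection \<open>Coordinates and Gram factorisation\<close>

lemma index_mult_mat_sum:
  assumes "A \<in> carrier_mat m k" "B \<in> carrier_mat k l" "i < m" "j < l"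
  shows "(A * B) $$ (i, j) = (\<Sum>s<k. A $$ (i, s) * B $$ (s, j))"
  using assms by (auto simp: scalar_prod_def lessThan_atLeast0 intro!: sum.cong)

lemma index_mult_mat_vec_sum:
  assumes "A \<in> carrier_mat m k" "w \<in> carrier_vec k" "i < m"
  shows "(A *\<^sub>v w) $ i = (\<Sum>s<k. A $$ (i, s) * w $ s)"
  using assms by (auto simp: scalar_prod_def lessThan_atLeast0 intro!: sum.cong)

lemma dim_mat_adjoint [simp]:
  "dim_row (mat_adjoint A) = dim_col A" "dim_col (mat_adjoint A) = dim_row A"
  by (auto simp: mat_adjoint_def)

lemma mat_adjoint_carrier [simp]: "A \<in> carrier_mat m k \<Longrightarrow> mat_adjoint A \<in> carrier_mat k m"
  by auto

lemma index_mat_adjoint [simp]: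
  fixes A :: "complex mat"
  assumes "i < dim_col A" "j < dim_row A"
  shows "mat_adjoint A $$ (i, j) = cnj (A $$ (j, i))"
  using assms by (auto simp: mat_adjoint_def mat_of_rows_index)

lemma cinner_sum:
  fixes a b :: "complex vec"
  assumes "a \<in> carrier_vec m" "b \<in> carrier_vec m"
  shows "conjugate a \<bullet> b = (\<Sum>i<m. cnj (a $ i) * b $ i)"
  using assms by (auto simp: scalar_prod_def lessThan_atLeast0)

text \<open>Cutting the range into \<open>k\<close> consecutive intervals of length \<open>a\<close>
  turns a sum over a tensor index into sums over its two lexicographic coordinates.\<close>

lemma sum_lessThan_mult:
  fixes f :: "nat \<Rightarrow> 'a :: comm_monoid_add"
  shows "(\<Sum>i<k * a. f i) = (\<Sum>c<k. \<Sum>s<a. f (c * a + s))"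
proof -
  have "(\<Sum>i<k * a. f i) = (\<Sum>c<k. sum f {c * a..<c * a + a})"
    by (simp add: sum.nat_group)
  also have "\<dots> = (\<Sum>c<k. \<Sum>s<a. f (c * a + s))"
    using sum.shift_bounds_nat_ivl[of f 0 "c * a" a for c]
    by (simp add: lessThan_atLeast0 add.commute)
  finally show ?thesis .
qed

lemma lex_index:
  fixes c s k a :: nat
  assumes "c < k" "s < a"
  shows "c * a + s < k * a" "(c * a + s) div a = c" "(c * a + s) mod a = s"
proof -
  have "c * a + s < (c + 1) * a" using assms by simp
  also have "\<dots> \<le> k * a" using assms by (intro mult_le_mono1) auto
  finally show "c * a + s < k * a" .
qed (use assms in auto)

lemma lex_div_mod:
  fixes i k a :: nat
  assumes "i < k * a"
  shows "i div a < k" "i mod a < a"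
  using assms by (auto simp: less_mult_imp_div_less) (metis gr_zeroI less_nat_zero_code mod_less_divisor mult_0_right)

text \<open>The induction step splits off an index \<open>e\<close>: the Schur complement of \<open>A e e\<close> is again
  positive semidefinite.\<close>

lemma psd_kernel_gram:
  fixes A :: "'a \<Rightarrow> 'a \<Rightarrow> complex"
  assumes "finite I"
    and "\<And>z. 0 \<le> (\<Sum>i\<in>I. \<Sum>j\<in>I. cnj (z i) * A i j * z j)"
  shows "\<exists>w. \<forall>i\<in>I. \<forall>j\<in>I. A i j = (\<Sum>l\<in>I. w l i * cnj (w l j))"
  using assms
proof (induction I arbitrary: A rule: finite_induct)
  case empty
  then show ?case by simp
next
  case (insert e I)
  define Q where "Q z = (\<Sum>i\<in>I. \<Sum>j\<in>I. cnj (z i) * A i j * z j)" for z :: "'a \<Rightarrow> complex"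
  have expand: "(\<Sum>i\<in>insert e I. \<Sum>j\<in>insert e I. cnj (z i) * A i j * z j) =
      cnj (z e) * A e e * z e + cnj (z e) * (\<Sum>j\<in>I. A e j * z j) +
      (\<Sum>i\<in>I. cnj (z i) * A i e) * z e + Q z" for z
    using insert.hyps
    by (simp add: Q_def sum.distrib sum_distrib_left sum_distrib_right algebra_simps)
  have psd: "0 \<le> cnj (z e) * A e e * z e + cnj (z e) * (\<Sum>j\<in>I. A e j * z j) +
      (\<Sum>i\<in>I. cnj (z i) * A i e) * z e + Q z" for z
    using insert.prems[of z] unfolding expand .
  have diag: "0 \<le> A e e"
  proof -
    have "Q (\<lambda>i. if i = e then 1 else 0) = 0" unfolding Q_def
      using insert.hyps by (intro sum.neutral ballI) auto
    moreover have "(\<Sum>j\<in>I. A e j * (if j = e then 1 else 0)) = 0"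
      "(\<Sum>i\<in>I. cnj (if i = e then 1 else 0) * A i e) = 0"
      using insert.hyps by (auto intro!: sum.neutral)
    ultimately show ?thesis using psd[of "\<lambda>i. if i = e then 1 else 0"] by simp
  qed
  \<comment> \<open>Test vectors supported on \<open>{e, j}\<close> isolate the 2 by 2 principal
    submatrix.\<close>
  have two: "0 \<le> cnj x * A e e * x + cnj x * A e j * y + cnj y * A j e * x + cnj y * A j j * y"
    if j: "j \<in> I" for j x y
  proof -
    have ne: "e \<noteq> j" using insert.hyps j by auto
    define z where "z i = (if i = e then x else if i = j then y else 0)" for i
    have z: "z i = (if i = j then y else 0)" if "i \<in> I" for i
      using insert.hyps that by (auto simp: z_def)
    have 1: "(\<Sum>k\<in>I. A e k * z k) = A e j * y"
      using insert.hyps j by (simp add: z if_distrib[of "\<lambda>t. _ * t"] cong: sum.cong if_cong)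
    have 2: "(\<Sum>k\<in>I. cnj (z k) * A k e) = cnj y * A j e"
      using insert.hyps j
      by (simp add: z if_distrib[of "\<lambda>t. t * _"] if_distrib[of cnj] cong: sum.cong if_cong)
    have 3: "Q z = cnj y * A j j * y"
      using insert.hyps j unfolding Q_def
      by (simp add: z if_distrib[of "\<lambda>t. t * _"] if_distrib[of "\<lambda>t. _ * t"] if_distrib[of cnj] cong: sum.cong if_cong)
    have "z e = x" by (simp add: z_def)
    then show ?thesis using psd[of z] unfolding 1 2 3 by (simp add: algebra_simps)
  qed
  \<comment> \<open>A nonnegative complex number is real: the test vectors \<open>(1, 1)\<close> and
    \<open>(1, \<i>)\<close> force the imaginary part of \<open>A e j + A j e\<close> and the real
    part of \<open>A e j - A j e\<close> to vanish.\<close>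
  have herm: "A j e = cnj (A e j)" if j: "j \<in> I" for j
  proof -
    have jj: "0 \<le> A j j" using two[OF j, of 0 1] by simp
    have "Im (A e j + A j e) = 0" using two[OF j, of 1 1] diag jj
      by (auto simp: less_eq_complex_def)
    moreover have "Re (A e j - A j e) = 0" using two[OF j, of 1 \<i>] diag jj
      by (auto simp: less_eq_complex_def)
    ultimately show ?thesis by (simp add: complex_eq_iff)
  qed
  show ?case
  proof (cases "A e e = 0")
    case True
    \<comment> \<open>With a zero diagonal entry, the form at \<open>(- t * A e j, 1)\<close> is
      affine in \<open>t\<close> with slope \<open>- 2 * N\<close>; staying nonnegative for all real
      \<open>t\<close> forces \<open>N = 0\<close>.\<close>
    have zero: "A e j = 0" if j: "j \<in> I" for j
    proof -
      define N where "N = (cmod (A e j))\<^sup>2"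
      have N: "A e j * cnj (A e j) = of_real N" "cnj (A e j) * A e j = of_real N"
        by (simp_all add: N_def complex_norm_square[symmetric] mult.commute)
      have jj: "0 \<le> A j j" using two[OF j, of 0 1] by simp
      have "0 \<le> - (2 * t * N) + Re (A j j)" for t :: real
      proof -
        have "0 \<le> cnj (- of_real t * A e j) * A e j + A j e * (- of_real t * A e j) + A j j"
          using two[OF j, of "- of_real t * A e j" 1] True by simp
        also have "\<dots> = - (2 * of_real t * of_real N) + A j j"
          unfolding herm[OF j] using N by (simp add: algebra_simps)
        finally show ?thesis by (simp add: less_eq_complex_def)
      qed
      \<comment> \<open>If \<open>N\<close> were nonzero, this value of \<open>t\<close> would make
        the right-hand side equal to -1.\<close>
      from this[of "(Re (A j j) + 1) / (2 * N)"] have "N = 0"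
        by (cases "N = 0") (auto simp: field_simps)
      then show ?thesis by (simp add: N_def)
    qed
    have "0 \<le> Q z" for z
      using psd[of z] True zero herm by simp
    then obtain w where w: "\<forall>i\<in>I. \<forall>j\<in>I. A i j = (\<Sum>l\<in>I. w l i * cnj (w l j))"
      using insert.IH[of A] unfolding Q_def by auto
    \<comment> \<open>Row and column \<open>e\<close> of \<open>A\<close> vanish, so the Gram vector
      at \<open>e\<close> and the additional component \<open>e\<close> are both set to
      zero.\<close>
    define w' where "w' l i = (if l = e \<or> i = e then 0 else w l i)" for l i
    have w'e: "w' l e = 0" "w' e i = 0" for l i by (auto simp: w'_def)
    have w'I: "w' l i = w l i" if "l \<in> I" "i \<in> I" for l i
      using that insert.hyps by (auto simp: w'_def)
    have "A i j = (\<Sum>l\<in>insert e I. w' l i * cnj (w' l j))"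
      if "i \<in> insert e I" "j \<in> insert e I" for i j
      using that insert.hyps True zero herm w by (auto simp: w'e w'I)
    then show ?thesis by blast
  next
    case False
    define \<alpha> where "\<alpha> = Re (A e e)"
    have Ae: "A e e = of_real \<alpha>" and \<alpha>: "\<alpha> > 0"
      using diag False by (auto simp: \<alpha>_def less_eq_complex_def complex_eq_iff less_le)
    have "0 \<le> (\<Sum>i\<in>I. \<Sum>j\<in>I. cnj (z i) * (A i j - A i e * A e j / of_real \<alpha>) * z j)" for z
    proof -
      define s where "s = (\<Sum>j\<in>I. A e j * z j)"
      \<comment> \<open>The coordinate at \<open>e\<close> minimises the form when the other
        coordinates are given; the minimum is the form of the Schur complement at
        \<open>z\<close>.\<close>
      define y where "y = z(e := - s / of_real \<alpha>)"
      have yI: "y i = z i" if "i \<in> I" for i using insert.hyps that by (auto simp: y_def)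
      have s': "(\<Sum>i\<in>I. cnj (z i) * A i e) = cnj s"
        by (simp add: s_def herm mult.commute)
      have "0 \<le> cnj (y e) * A e e * y e + cnj (y e) * s + cnj s * y e + Q y"
        using psd[of y] by (simp add: yI s_def[symmetric] s' cong: sum.cong)
      also have "Q y = Q z" by (simp add: Q_def yI cong: sum.cong)
      also have "y e = - s / of_real \<alpha>" by (simp add: y_def)
      also have "cnj (- s / of_real \<alpha>) * A e e * (- s / of_real \<alpha>) + cnj (- s / of_real \<alpha>) * s +
          cnj s * (- s / of_real \<alpha>) + Q z = Q z - cnj s * s / of_real \<alpha>"
        using \<alpha> by (simp add: Ae field_simps)
      also have "cnj s * s / of_real \<alpha> = (\<Sum>i\<in>I. \<Sum>j\<in>I. cnj (z i) * (A i e * A e j / of_real \<alpha>) * z j)"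
        unfolding s'[symmetric] unfolding s_def sum_product sum_divide_distrib by (simp add: mult_ac)
      also have "Q z - \<dots> = (\<Sum>i\<in>I. \<Sum>j\<in>I. cnj (z i) * (A i j - A i e * A e j / of_real \<alpha>) * z j)"
        unfolding Q_def by (simp add: sum_subtractf algebra_simps)
      finally show ?thesis .
    qed
    from insert.IH[OF this] obtain w where
      w: "\<And>i j. i \<in> I \<Longrightarrow> j \<in> I \<Longrightarrow> A i j - A i e * A e j / of_real \<alpha> = (\<Sum>l\<in>I. w l i * cnj (w l j))"
      by blast
    \<comment> \<open>Component \<open>e\<close> carries the rank-one term
      \<open>A i e * A e j / \<alpha>\<close> that the Schur complement removed. The old components
      vanish at \<open>e\<close>, where the complement is zero.\<close>
    define w' where "w' l i = (if l = e then A i e / of_real (sqrt \<alpha>) else if i = e then 0 else w l i)" for l i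
    have w'I: "w' l i = w l i" if "l \<in> I" "i \<in> I" for l i
      using that insert.hyps by (auto simp: w'_def)
    have w'0: "w' l e = 0" if "l \<in> I" for l
      using that insert.hyps by (auto simp: w'_def)
    have w'e: "w' e i * cnj (w' e j) = A i e * cnj (A j e) / of_real \<alpha>" for i j
      using \<alpha> by (simp add: w'_def flip: of_real_mult)
    have herm': "cnj (A j e) = A e j" if "j \<in> insert e I" for j
      using that herm Ae by auto
    have "A i j = (\<Sum>l\<in>insert e I. w' l i * cnj (w' l j))"
      if "i \<in> insert e I" "j \<in> insert e I" for i j
    proof -
      have "(\<Sum>l\<in>insert e I. w' l i * cnj (w' l j)) =
          A i e * A e j / of_real \<alpha> + (\<Sum>l\<in>I. w' l i * cnj (w' l j))"
        using insert.hyps that by (simp add: w'e herm')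
      also have "\<dots> = A i j"
      proof (cases "i = e \<or> j = e")
        case True
        then show ?thesis using \<alpha> by (auto simp: w'0 Ae)
      next
        case False
        then have "i \<in> I" "j \<in> I" using that by auto
        then show ?thesis using w[of i j] by (simp add: w'I algebra_simps cong: sum.cong)
      qed
      finally show ?thesis by simp
    qed
    then show ?thesis by blast
  qed
qed

subsection \<open>Unitary matrices and equal Gram matrices\<close>

lemma cinner_mult_mat_vec:
  fixes A :: "complex mat"
  assumes "A \<in> carrier_mat m k" "a \<in> carrier_vec k" "b \<in> carrier_vec m"
  shows "conjugate (A *\<^sub>v a) \<bullet> b = conjugate a \<bullet> (mat_adjoint A *\<^sub>v b)"
proof -
  have "conjugate (A *\<^sub>v a) \<bullet> b = (\<Sum>i<m. \<Sum>s<k. cnj (A $$ (i, s) * a $ s) * b $ i)"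
    using assms by (simp add: cinner_sum[of _ m] index_mult_mat_vec_sum[of _ m k] sum_distrib_right
      del: index_mult_mat_vec)
  also have "\<dots> = (\<Sum>s<k. \<Sum>i<m. cnj (A $$ (i, s) * a $ s) * b $ i)"
    by (rule sum.swap)
  also have "\<dots> = (\<Sum>s<k. cnj (a $ s) * (mat_adjoint A *\<^sub>v b) $ s)"
    using assms by (intro sum.cong refl)
      (simp add: index_mult_mat_vec_sum[of _ k m] sum_distrib_left mult_ac del: index_mult_mat_vec)
  also have "\<dots> = conjugate a \<bullet> (mat_adjoint A *\<^sub>v b)"
    using assms by (intro cinner_sum[of _ k, symmetric]) (auto intro!: mult_mat_vec_carrier[of _ k m])
  finally show ?thesis .
qed

lemma unitary_mat_cinner:
  assumes "unitary_mat m U" "a \<in> carrier_vec m" "b \<in> carrier_vec m"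
  shows "conjugate (U *\<^sub>v a) \<bullet> (U *\<^sub>v b) = conjugate a \<bullet> b"
proof -
  have U: "U \<in> carrier_mat m m" "mat_adjoint U * U = 1\<^sub>m m"
    using assms by (auto simp: unitary_mat_def)
  have "conjugate (U *\<^sub>v a) \<bullet> (U *\<^sub>v b) = conjugate a \<bullet> (mat_adjoint U *\<^sub>v (U *\<^sub>v b))"
    using assms U by (intro cinner_mult_mat_vec[of _ m m]) auto
  also have "mat_adjoint U *\<^sub>v (U *\<^sub>v b) = b"
    using assms U by (subst assoc_mult_mat_vec[of _ m m _ m, symmetric]) auto
  finally show ?thesis .
qed

lemma mat_adjoint_mult:
  fixes A B :: "complex mat"
  assumes "A \<in> carrier_mat m k" "B \<in> carrier_mat k l"
  shows "mat_adjoint (A * B) = mat_adjoint B * mat_adjoint A"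
proof (rule eq_matI)
  fix i j assume "i < dim_row (mat_adjoint B * mat_adjoint A)" "j < dim_col (mat_adjoint B * mat_adjoint A)"
  then have ij: "i < l" "j < m" using assms by auto
  have "mat_adjoint (A * B) $$ (i, j) = cnj (\<Sum>s<k. A $$ (j, s) * B $$ (s, i))"
    using assms ij index_mult_mat_sum[OF assms ij(2,1)] by simp
  also have "\<dots> = (mat_adjoint B * mat_adjoint A) $$ (i, j)"
    using assms ij by (subst index_mult_mat_sum[of _ l k _ m]) (auto simp: mult.commute)
  finally show "mat_adjoint (A * B) $$ (i, j) = (mat_adjoint B * mat_adjoint A) $$ (i, j)" .
qed (use assms in auto)

text \<open>A left inverse of a square matrix is also a right inverse.\<close>

lemma unitary_matI:
  assumes "U \<in> carrier_mat m m" "mat_adjoint U * U = 1\<^sub>m m"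
  shows "unitary_mat m U"
  using assms mat_mult_left_right_inverse[of "mat_adjoint U" m U]
  by (simp add: unitary_mat_def)

lemma unitary_mat_one: "unitary_mat m (1\<^sub>m m)"
proof -
  have "mat_adjoint (1\<^sub>m m) = (1\<^sub>m m :: complex mat)" by (rule eq_matI) auto
  then show ?thesis by (simp add: unitary_mat_def)
qed

lemma unitary_mat_mult:
  assumes "unitary_mat m U" "unitary_mat m V"
  shows "unitary_mat m (U * V)"
proof (rule unitary_matI)
  have U: "U \<in> carrier_mat m m" "mat_adjoint U * U = 1\<^sub>m m"
    and V: "V \<in> carrier_mat m m" "mat_adjoint V * V = 1\<^sub>m m"
    using assms by (auto simp: unitary_mat_def)
  show "U * V \<in> carrier_mat m m" using U V by simp
  have "mat_adjoint (U * V) * (U * V) = mat_adjoint V * ((mat_adjoint U * U) * V)"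
    using U(1) V(1) by (simp add: mat_adjoint_mult[of _ m m _ m] assoc_mult_mat[of _ m m _ m _ m]
      mult_carrier_mat[of _ m m _ m])
  then show "mat_adjoint (U * V) * (U * V) = 1\<^sub>m m"
    using U V by simp
qed

text \<open>The reflection is \<open>1 - \<tau> w w\<^sup>*\<close> with \<open>w = c - b\<close> and \<open>\<tau> = 1 / (w\<^sup>* c)\<close>; it is unitary
  because \<open>2 Re (w\<^sup>* c) = w\<^sup>* w\<close>.\<close>

lemma householder_reflection:
  fixes b c :: "complex vec"
  assumes b: "b \<in> carrier_vec m" and c: "c \<in> carrier_vec m"
    and norm: "conjugate c \<bullet> c = conjugate b \<bullet> b"
  shows "\<exists>H. unitary_mat m H \<and> H *\<^sub>v c = b \<and>
    (\<forall>y\<in>carrier_vec m. conjugate c \<bullet> y = conjugate b \<bullet> y \<longrightarrow> H *\<^sub>v y = y)"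
proof (cases "c = b")
  case True
  from True b unitary_mat_one show ?thesis by (intro exI[of _ "1\<^sub>m m"]) auto
next
  case False
  define w where "w i = c $ i - b $ i" for i
  define s where "s = (\<Sum>i<m. cnj (w i) * c $ i)"
  define \<tau> where "\<tau> = 1 / s"
  define N where "N = (\<Sum>i<m. cnj (w i) * w i)"
  have sN: "s + cnj s = N"
  proof -
    have "(\<Sum>i<m. cnj (c $ i) * c $ i) = (\<Sum>i<m. cnj (b $ i) * b $ i)"
      using norm b c by (simp add: cinner_sum[of _ m])
    then show ?thesis
      by (simp add: s_def N_def w_def algebra_simps sum.distrib sum_subtractf)
  qed
  have "N \<noteq> 0"
  proof
    assume "N = 0"
    then have "of_real (\<Sum>i<m. (cmod (w i))\<^sup>2) = (0 :: complex)"
      by (simp add: N_def complex_norm_square mult.commute del: of_real_power)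
    then have "(\<Sum>i<m. (cmod (w i))\<^sup>2) = 0" by (simp only: of_real_eq_0_iff)
    then have "\<forall>i<m. w i = 0" by (simp add: sum_nonneg_eq_0_iff)
    then have "c = b" using b c by (intro eq_vecI) (auto simp: w_def)
    with False show False ..
  qed
  \<comment> \<open>If \<open>s\<close> were zero, \<open>sN\<close> would make \<open>N\<close>
    zero as well.\<close>
  then have s0: "s \<noteq> 0" using sN by auto
  \<comment> \<open>In this form the two linear terms of \<open>H* H\<close> cancel against the
    quadratic one.\<close>
  have \<tau>N: "\<tau> + cnj \<tau> = cnj \<tau> * \<tau> * N"
    using s0 unfolding \<tau>_def sN[symmetric] by (simp add: field_simps)
  define H where "H = mat m m (\<lambda>(i, j). (if i = j then 1 else 0) - \<tau> * w i * cnj (w j))"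
  have H: "H \<in> carrier_mat m m" by (simp add: H_def)
  have Hy: "(H *\<^sub>v y) $ i = y $ i - \<tau> * w i * (\<Sum>j<m. cnj (w j) * y $ j)"
    if "y \<in> carrier_vec m" "i < m" for y i
  proof -
    have "(H *\<^sub>v y) $ i = (\<Sum>j<m. (if i = j then y $ j else 0) - \<tau> * w i * (cnj (w j) * y $ j))"
      using that H unfolding index_mult_mat_vec_sum[OF H that]
      by (intro sum.cong refl) (auto simp: H_def algebra_simps)
    then show ?thesis using that by (simp add: sum_subtractf sum_distrib_left)
  qed
  have "unitary_mat m H"
  proof (rule unitary_matI[OF H], rule eq_matI)
    fix i j assume "i < dim_row (1\<^sub>m m)" "j < dim_col (1\<^sub>m m)"
    then have ij: "i < m" "j < m" by auto
    have "(mat_adjoint H * H) $$ (i, j) = (\<Sum>k<m. cnj (H $$ (k, i)) * H $$ (k, j))"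
      using H ij by (simp add: index_mult_mat_sum[of _ m m _ m] del: index_mult_mat(1))
    also have "\<dots> = (\<Sum>k<m. (if k = i then (if i = j then 1 else 0) else 0)
        - (if k = i then \<tau> * w k * cnj (w j) else 0) - (if k = j then cnj \<tau> * cnj (w k) * w i else 0)
        + cnj \<tau> * \<tau> * w i * cnj (w j) * (cnj (w k) * w k))"
      using ij by (intro sum.cong refl) (auto simp: H_def algebra_simps)
    also have "\<dots> = (if i = j then 1 else 0) - (\<tau> + cnj \<tau>) * (w i * cnj (w j))
        + cnj \<tau> * \<tau> * N * (w i * cnj (w j))"
      using ij unfolding N_def
      by (simp add: sum.distrib sum_subtractf sum_distrib_left sum_distrib_right algebra_simps)
    finally show "(mat_adjoint H * H) $$ (i, j) = 1\<^sub>m m $$ (i, j)"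
      using ij unfolding \<tau>N by simp
  qed (use H in auto)
  moreover have "H *\<^sub>v c = b"
  proof (rule eq_vecI)
    fix i assume "i < dim_vec b"
    then have i: "i < m" using b by simp
    \<comment> \<open>Since \<open>\<tau> s = 1\<close>,
      \<open>H c = c - \<tau> s w = c - w = b\<close>.\<close>
    show "(H *\<^sub>v c) $ i = b $ i"
      using s0 unfolding Hy[OF c i] s_def[symmetric] \<tau>_def by (simp add: w_def)
  qed (use b H in auto)
  moreover have "H *\<^sub>v y = y" if y: "y \<in> carrier_vec m" "conjugate c \<bullet> y = conjugate b \<bullet> y" for y
  proof -
    have "(\<Sum>j<m. cnj (w j) * y $ j) = 0"
      using y b c by (simp add: cinner_sum[of _ m] w_def algebra_simps sum_subtractf)
    with y H show ?thesis by (intro eq_vecI) (auto simp: Hy simp del: index_mult_mat_vec)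
  qed
  ultimately show ?thesis by blast
qed

text \<open>Induction on \<open>n\<close>: after a unitary has placed the first \<open>n\<close>
  vectors, a reflection carries the image of the last one to its target. It fixes the vectors
  already placed, since equal Gram matrices give them the same inner product with that image and
  with the target.\<close>

lemma equal_gram_unitary:
  fixes a b :: "nat \<Rightarrow> complex vec"
  assumes "\<And>i. i < n \<Longrightarrow> a i \<in> carrier_vec m" "\<And>i. i < n \<Longrightarrow> b i \<in> carrier_vec m"
    and "\<And>i j. i < n \<Longrightarrow> j < n \<Longrightarrow> conjugate (a i) \<bullet> a j = conjugate (b i) \<bullet> b j"
  shows "\<exists>U. unitary_mat m U \<and> (\<forall>i<n. U *\<^sub>v a i = b i)"
  using assms
proof (induction n)
  case 0
  from unitary_mat_one show ?case by auto
next
  case (Suc n)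
  then obtain U where U: "unitary_mat m U" and Ua: "\<And>i. i < n \<Longrightarrow> U *\<^sub>v a i = b i"
    by (metis less_SucI)
  have Uc: "U \<in> carrier_mat m m" using U by (simp add: unitary_mat_def)
  define c where "c = U *\<^sub>v a n"
  have c: "c \<in> carrier_vec m" using Uc Suc.prems(1)[of n] by (simp add: c_def)
  have "conjugate c \<bullet> c = conjugate (b n) \<bullet> b n"
    using Suc.prems(1)[of n] Suc.prems(3)[of n n] by (simp add: c_def unitary_mat_cinner[OF U])
  from householder_reflection[OF Suc.prems(2)[of n] c this] obtain H where
    H: "unitary_mat m H" and Hc: "H *\<^sub>v c = b n" and
    Hy: "\<And>y. y \<in> carrier_vec m \<Longrightarrow> conjugate c \<bullet> y = conjugate (b n) \<bullet> y \<Longrightarrow> H *\<^sub>v y = y"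
    by auto
  have Hcar: "H \<in> carrier_mat m m" using H by (simp add: unitary_mat_def)
  have "(H * U) *\<^sub>v a i = b i" if i: "i < Suc n" for i
  proof (cases "i = n")
    case True
    then show ?thesis using Hcar Uc Suc.prems(1)[OF i] Hc by (simp add: c_def assoc_mult_mat_vec[of _ m m _ m])
  next
    case False
    then have i': "i < n" using i by simp
    have "conjugate c \<bullet> b i = conjugate (a n) \<bullet> a i"
      unfolding c_def Ua[OF i', symmetric]
      using Suc.prems(1)[of n] Suc.prems(1)[OF i] by (simp add: unitary_mat_cinner[OF U])
    also have "\<dots> = conjugate (b n) \<bullet> b i" using Suc.prems(3)[of n i] i by simp
    finally have "H *\<^sub>v b i = b i" using Hy Suc.prems(2)[OF i] by blast
    then show ?thesis
      using Hcar Uc Suc.prems(1)[OF i] Ua[OF i'] by (simp add: assoc_mult_mat_vec[of _ m m _ m])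
  qed
  with unitary_mat_mult[OF H U] show ?case by blast
qed

subsection \<open>Kraus representations\<close>

lemma mat_adjoint_mat_adjoint [simp]: "mat_adjoint (mat_adjoint A) = (A :: complex mat)"
  by (rule eq_matI) auto

lemma cinner_form_sum:
  fixes A :: "complex mat"
  assumes "A \<in> carrier_mat m m" "y \<in> carrier_vec m" "z \<in> carrier_vec m"
  shows "conjugate y \<bullet> (A *\<^sub>v z) = (\<Sum>i<m. \<Sum>j<m. cnj (y $ i) * A $$ (i, j) * z $ j)"
proof -
  have "conjugate y \<bullet> (A *\<^sub>v z) = (\<Sum>i<m. cnj (y $ i) * (A *\<^sub>v z) $ i)"
    using assms by (intro cinner_sum) (auto intro!: mult_mat_vec_carrier[of _ m m])
  also have "\<dots> = (\<Sum>i<m. \<Sum>j<m. cnj (y $ i) * A $$ (i, j) * z $ j)"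
    using assms index_mult_mat_vec_sum[OF assms(1,3)]
    by (intro sum.cong refl) (simp add: sum_distrib_left mult.assoc del: index_mult_mat_vec)
  finally show ?thesis .
qed

lemma cinner_sum_mats:
  assumes A: "\<And>l. l < r \<Longrightarrow> A l \<in> carrier_mat m m"
    and y: "y \<in> carrier_vec m" and z: "z \<in> carrier_vec m"
  shows "conjugate y \<bullet> (sum_mats m m r A *\<^sub>v z) = (\<Sum>l<r. conjugate y \<bullet> (A l *\<^sub>v z))"
proof -
  have S: "sum_mats m m r A \<in> carrier_mat m m" by (simp add: sum_mats_def)
  have "conjugate y \<bullet> (sum_mats m m r A *\<^sub>v z) =
      (\<Sum>i<m. \<Sum>j<m. \<Sum>l<r. cnj (y $ i) * A l $$ (i, j) * z $ j)"
    unfolding cinner_form_sum[OF S y z]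
    by (simp add: sum_mats_def sum_distrib_left sum_distrib_right)
  also have "\<dots> = (\<Sum>i<m. \<Sum>l<r. \<Sum>j<m. cnj (y $ i) * A l $$ (i, j) * z $ j)"
    by (intro sum.cong refl sum.swap)
  also have "\<dots> = (\<Sum>l<r. \<Sum>i<m. \<Sum>j<m. cnj (y $ i) * A l $$ (i, j) * z $ j)"
    by (rule sum.swap)
  also have "\<dots> = (\<Sum>l<r. conjugate y \<bullet> (A l *\<^sub>v z))"
    using A y z by (intro sum.cong refl cinner_form_sum[symmetric]) auto
  finally show ?thesis .
qed

text \<open>The form at \<open>z\<close> equals the form of \<open>X\<close> at
  \<open>y = G* z\<close>.\<close>

lemma psd_mat_conj:
  assumes "psd_mat a X" "G \<in> carrier_mat b a"
  shows "psd_mat b (G * X * mat_adjoint G)"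
  unfolding psd_mat_def
proof (intro conjI ballI)
  have X: "X \<in> carrier_mat a a" using assms by (simp add: psd_mat_def)
  show "G * X * mat_adjoint G \<in> carrier_mat b b"
    using X assms by (intro mult_carrier_mat[of _ b a]) auto
  fix z :: "complex vec" assume z: "z \<in> carrier_vec b"
  define y where "y = mat_adjoint G *\<^sub>v z"
  have y: "y \<in> carrier_vec a" using z assms by (auto simp: y_def intro!: mult_mat_vec_carrier[of _ a b])
  have "(G * X * mat_adjoint G) *\<^sub>v z = G *\<^sub>v (X *\<^sub>v y)"
    unfolding y_def using X z assms
    by (simp add: assoc_mult_mat_vec[of _ b a _ b] assoc_mult_mat_vec[of _ b a _ a]
      mult_carrier_mat[of _ b a _ a] mult_mat_vec_carrier[of _ a b])
  moreover have "conjugate y \<bullet> (X *\<^sub>v y) = conjugate z \<bullet> (G *\<^sub>v (X *\<^sub>v y))"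
    using cinner_mult_mat_vec[of "mat_adjoint G" a b z "X *\<^sub>v y"] X y z assms
    by (simp add: y_def[symmetric] mult_mat_vec_carrier[of _ a a])
  moreover have "0 \<le> conjugate y \<bullet> (X *\<^sub>v y)"
    using assms(1) y by (simp add: psd_mat_def)
  ultimately show "0 \<le> conjugate z \<bullet> ((G * X * mat_adjoint G) *\<^sub>v z)"
    by simp
qed

lemma psd_mat_sum_mats:
  assumes "\<And>l. l < r \<Longrightarrow> psd_mat m (A l)"
  shows "psd_mat m (sum_mats m m r A)"
  unfolding psd_mat_def
proof (intro conjI ballI)
  show "sum_mats m m r A \<in> carrier_mat m m" by (simp add: sum_mats_def)
  fix z :: "complex vec" assume z: "z \<in> carrier_vec m"
  have "conjugate z \<bullet> (sum_mats m m r A *\<^sub>v z) = (\<Sum>l<r. conjugate z \<bullet> (A l *\<^sub>v z))"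
    using assms z by (intro cinner_sum_mats) (auto simp: psd_mat_def)
  also have "0 \<le> \<dots>"
    using assms z by (intro sum_nonneg) (auto simp: psd_mat_def)
  finally show "0 \<le> conjugate z \<bullet> (sum_mats m m r A *\<^sub>v z)" .
qed

text \<open>The form at \<open>z\<close> is the squared modulus of the sum of the
  \<open>f j * z $ j\<close>.\<close>

lemma psd_mat_rank_one:
  fixes f :: "nat \<Rightarrow> complex"
  shows "psd_mat m (mat m m (\<lambda>(i, j). cnj (f i) * f j))" (is "psd_mat m ?A")
  unfolding psd_mat_def
proof (intro conjI ballI)
  show A: "?A \<in> carrier_mat m m" by simp
  fix z :: "complex vec" assume z: "z \<in> carrier_vec m"
  have "conjugate z \<bullet> (?A *\<^sub>v z) = (\<Sum>i<m. \<Sum>j<m. (cnj (z $ i) * cnj (f i)) * (f j * z $ j))"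
    unfolding cinner_form_sum[OF A z z] by (intro sum.cong refl) (simp add: mult_ac)
  also have "\<dots> = (\<Sum>i<m. cnj (z $ i) * cnj (f i)) * (\<Sum>j<m. f j * z $ j)"
    by (rule sum_product[symmetric])
  also have "(\<Sum>i<m. cnj (z $ i) * cnj (f i)) = cnj (\<Sum>j<m. f j * z $ j)"
    by (simp add: mult.commute)
  also have "cnj y * y = of_real ((cmod y)\<^sup>2)" for y
    by (simp only: complex_norm_square mult.commute)
  finally show "0 \<le> conjugate z \<bullet> (?A *\<^sub>v z)"
    by (simp add: less_eq_complex_def)
qed

section \<open>Kraus maps and trace preservation\<close>

definition kraus_map :: "nat \<Rightarrow> nat \<Rightarrow> (nat \<Rightarrow> complex mat) \<Rightarrow> complex mat \<Rightarrow> complex mat" where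
  "kraus_map b r G X = sum_mats b b r (\<lambda>l. G l * X * mat_adjoint (G l))"

text \<open>The normalisation amounts to trace preservation of \<open>kraus_map\<close>, see
  \<open>trace_preserving_kraus_family_iff\<close>.\<close>

definition kraus_family :: "nat \<Rightarrow> nat \<Rightarrow> nat \<Rightarrow> (nat \<Rightarrow> complex mat) \<Rightarrow> bool" where
  "kraus_family a b r G \<longleftrightarrow> (\<forall>l<r. G l \<in> carrier_mat b a) \<and>
     sum_mats a a r (\<lambda>l. mat_adjoint (G l) * G l) = 1\<^sub>m a"

lemma index_conj_mat:
  fixes G X :: "complex mat"
  assumes "G \<in> carrier_mat b a" "X \<in> carrier_mat a a" "i < b" "j < b"
  shows "(G * X * mat_adjoint G) $$ (i, j) =
    (\<Sum>s<a. \<Sum>t<a. G $$ (i, s) * X $$ (s, t) * cnj (G $$ (j, t)))"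
proof -
  have "(G * X * mat_adjoint G) $$ (i, j) = (\<Sum>t<a. (G * X) $$ (i, t) * mat_adjoint G $$ (t, j))"
    using assms by (intro index_mult_mat_sum[of _ b a _ b]) (auto intro: mult_carrier_mat[of _ b a])
  also have "\<dots> = (\<Sum>t<a. \<Sum>s<a. G $$ (i, s) * X $$ (s, t) * cnj (G $$ (j, t)))"
    using assms
    by (intro sum.cong refl) (simp add: index_mult_mat_sum[of _ b a _ a] sum_distrib_right del: index_mult_mat(1))
  finally show ?thesis by (subst sum.swap)
qed

lemma kraus_map_carrier [simp]: "kraus_map b r G X \<in> carrier_mat b b"
  by (simp add: kraus_map_def sum_mats_def)

lemma dim_kraus_map [simp]: "dim_row (kraus_map b r G X) = b" "dim_col (kraus_map b r G X) = b"
  by (simp_all add: kraus_map_def sum_mats_def)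

lemma index_kraus_map:
  assumes "\<forall>l<r. G l \<in> carrier_mat b a" "X \<in> carrier_mat a a" "i < b" "j < b"
  shows "kraus_map b r G X $$ (i, j) =
    (\<Sum>l<r. \<Sum>s<a. \<Sum>t<a. G l $$ (i, s) * X $$ (s, t) * cnj (G l $$ (j, t)))"
  using assms unfolding kraus_map_def sum_mats_def
  by (simp add: index_conj_mat[of _ b a] del: index_mult_mat(1))

lemma linear_map_kraus_map:
  assumes "\<forall>l<r. G l \<in> carrier_mat b a"
  shows "linear_map_mat a b (kraus_map b r G)"
  unfolding linear_map_mat_def
proof (intro conjI ballI allI)
  fix X Y :: "complex mat" and c
  assume X: "X \<in> carrier_mat a a"
  note idx = index_kraus_map[OF assms]
  show "kraus_map b r G (c \<cdot>\<^sub>m X) = c \<cdot>\<^sub>m kraus_map b r G X"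
    using X by (intro eq_matI) (simp_all add: idx[where X = X] idx[where X = "c \<cdot>\<^sub>m X"] sum_distrib_left mult_ac)
  assume Y: "Y \<in> carrier_mat a a"
  show "kraus_map b r G (X + Y) = kraus_map b r G X + kraus_map b r G Y"
    using X Y by (intro eq_matI)
      (simp_all add: idx[where X = X] idx[where X = Y] idx[where X = "X + Y"] sum.distrib algebra_simps)
qed simp

text \<open>Cyclicity of the trace, in entries: \<open>G X G*\<close> and \<open>X G* G\<close> have
  the same trace, and moving the sums over \<open>l\<close> and \<open>i\<close> inside pairs
  \<open>X\<close> with the sum of the \<open>G* G\<close>.\<close>

lemma trace_kraus_map:
  assumes "\<forall>l<r. G l \<in> carrier_mat b a" "X \<in> carrier_mat a a"
  shows "trace_mat (kraus_map b r G X) =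
    (\<Sum>s<a. \<Sum>t<a. X $$ (s, t) * sum_mats a a r (\<lambda>l. mat_adjoint (G l) * G l) $$ (t, s))"
proof -
  have gram: "sum_mats a a r (\<lambda>l. mat_adjoint (G l) * G l) $$ (t, s) =
      (\<Sum>l<r. \<Sum>i<b. cnj (G l $$ (i, t)) * G l $$ (i, s))" if "s < a" "t < a" for s t
    unfolding sum_mats_def using that
  proof simp
    have "(mat_adjoint (G l) * G l) $$ (t, s) = (\<Sum>i<b. cnj (G l $$ (i, t)) * G l $$ (i, s))"
      if "l < r" for l
      using assms(1)[rule_format, OF that] \<open>s < a\<close> \<open>t < a\<close>
      by (subst index_mult_mat_sum[of _ a b _ a]) auto
    then show "(\<Sum>l<r. (mat_adjoint (G l) * G l) $$ (t, s)) =
        (\<Sum>l<r. \<Sum>i<b. cnj (G l $$ (i, t)) * G l $$ (i, s))" by simp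
  qed
  have "trace_mat (kraus_map b r G X) =
      (\<Sum>i<b. \<Sum>l<r. \<Sum>s<a. \<Sum>t<a. G l $$ (i, s) * X $$ (s, t) * cnj (G l $$ (i, t)))"
    by (simp add: trace_mat_def index_kraus_map[OF assms])
  also have "\<dots> = (\<Sum>l<r. \<Sum>i<b. \<Sum>s<a. \<Sum>t<a. G l $$ (i, s) * X $$ (s, t) * cnj (G l $$ (i, t)))"
    by (rule sum.swap)
  also have "\<dots> = (\<Sum>l<r. \<Sum>s<a. \<Sum>i<b. \<Sum>t<a. G l $$ (i, s) * X $$ (s, t) * cnj (G l $$ (i, t)))"
    by (intro sum.cong refl sum.swap)
  also have "\<dots> = (\<Sum>s<a. \<Sum>l<r. \<Sum>i<b. \<Sum>t<a. G l $$ (i, s) * X $$ (s, t) * cnj (G l $$ (i, t)))"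
    by (rule sum.swap)
  also have "\<dots> = (\<Sum>s<a. \<Sum>l<r. \<Sum>t<a. \<Sum>i<b. G l $$ (i, s) * X $$ (s, t) * cnj (G l $$ (i, t)))"
    by (intro sum.cong refl sum.swap)
  also have "\<dots> = (\<Sum>s<a. \<Sum>t<a. \<Sum>l<r. \<Sum>i<b. G l $$ (i, s) * X $$ (s, t) * cnj (G l $$ (i, t)))"
    by (intro sum.cong refl sum.swap)
  also have "\<dots> = (\<Sum>s<a. \<Sum>t<a. X $$ (s, t) * sum_mats a a r (\<lambda>l. mat_adjoint (G l) * G l) $$ (t, s))"
    by (intro sum.cong refl) (simp add: gram sum_distrib_left mult_ac)
  finally show ?thesis .
qed

definition mat_unit :: "nat \<Rightarrow> nat \<Rightarrow> nat \<Rightarrow> complex mat" where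
  "mat_unit a s t = mat a a (\<lambda>ij. if ij = (s, t) then 1 else 0)"

lemma mat_unit_carrier [simp]: "mat_unit a s t \<in> carrier_mat a a"
  by (simp add: mat_unit_def)

text \<open>With \<open>M\<close> the sum of the \<open>G* G\<close>, trace preservation says that
  \<open>X M\<close> and \<open>X\<close> have equal traces for all \<open>X\<close>; testing on
  matrix units recovers every entry of \<open>M\<close>.\<close>

lemma trace_preserving_kraus_family_iff:
  assumes G: "\<forall>l<r. G l \<in> carrier_mat b a"
  shows "(\<forall>X\<in>carrier_mat a a. trace_mat (kraus_map b r G X) = trace_mat X) \<longleftrightarrow> kraus_family a b r G"
proof
  assume "kraus_family a b r G"
  then have M: "sum_mats a a r (\<lambda>l. mat_adjoint (G l) * G l) = 1\<^sub>m a"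
    by (simp add: kraus_family_def)
  show "\<forall>X\<in>carrier_mat a a. trace_mat (kraus_map b r G X) = trace_mat X"
  proof
    fix X :: "complex mat" assume X: "X \<in> carrier_mat a a"
    have "trace_mat (kraus_map b r G X) = (\<Sum>s<a. \<Sum>t<a. if t = s then X $$ (s, s) else 0)"
      unfolding trace_kraus_map[OF G X] M by (intro sum.cong refl) auto
    then show "trace_mat (kraus_map b r G X) = trace_mat X"
      using X by (simp add: trace_mat_def)
  qed
next
  assume tr: "\<forall>X\<in>carrier_mat a a. trace_mat (kraus_map b r G X) = trace_mat X"
  define M where "M = sum_mats a a r (\<lambda>l. mat_adjoint (G l) * G l)"
  have "M $$ (t, s) = 1\<^sub>m a $$ (t, s)" if st: "s < a" "t < a" for s t
  proof -
    have "trace_mat (kraus_map b r G (mat_unit a s t)) =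
        (\<Sum>s'<a. \<Sum>t'<a. if s' = s then (if t' = t then M $$ (t, s) else 0) else 0)"
      unfolding trace_kraus_map[OF G mat_unit_carrier] M_def[symmetric]
      by (intro sum.cong refl) (auto simp: mat_unit_def)
    also have "\<dots> = (\<Sum>s'<a. if s' = s then M $$ (t, s) else 0)"
      using st by (intro sum.cong refl) auto
    also have "\<dots> = M $$ (t, s)" using st by simp
    finally have "M $$ (t, s) = trace_mat (mat_unit a s t)"
      using tr[rule_format, of "mat_unit a s t"] by simp
    also have "\<dots> = (\<Sum>i<a. if i = s then (if s = t then 1 else 0) else 0)"
      unfolding trace_mat_def by (intro sum.cong) (auto simp: mat_unit_def)
    also have "\<dots> = 1\<^sub>m a $$ (t, s)" using st by simp
    finally show ?thesis .
  qed
  then have "M = 1\<^sub>m a" by (intro eq_matI) (auto simp: M_def sum_mats_def)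
  with G show "kraus_family a b r G" by (simp add: kraus_family_def M_def)
qed

section \<open>Ampliations as conjugations by block diagonal matrices\<close>

lemma kron_one_carrier [simp]:
  "G \<in> carrier_mat b a \<Longrightarrow> kron_mat (1\<^sub>m k) G \<in> carrier_mat (k * b) (k * a)"
  by (auto simp: kron_mat_def)

lemma index_kron_one:
  assumes "G \<in> carrier_mat b a" "i < k * b" "j < k * a"
  shows "kron_mat (1\<^sub>m k) G $$ (i, j) = (if i div b = j div a then G $$ (i mod b, j mod a) else 0)"
  using assms lex_div_mod[of i k b] lex_div_mod[of j k a] by (auto simp: kron_mat_def)

text \<open>Needed where a Kronecker delta on the outer lexicographic coordinate stands inside the
  inner sum.\<close>

lemma sum_sum_delta:
  fixes f :: "nat \<Rightarrow> nat \<Rightarrow> 'a :: comm_monoid_add"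
  assumes "c < k"
  shows "(\<Sum>c'<k. \<Sum>t<a. if c' = c then f c' t else 0) = (\<Sum>t<a. f c t)"
proof -
  have "(\<Sum>c'<k. \<Sum>t<a. if c' = c then f c' t else 0) = (\<Sum>c'<k. if c' = c then \<Sum>t<a. f c' t else 0)"
    by (rule sum.cong) auto
  then show ?thesis using assms by simp
qed

text \<open>\<open>kron_mat (1\<^sub>m k) G\<close> is block diagonal, so conjugation by it acts on
  each \<open>a\<close> by \<open>a\<close> block separately, as conjugation by
  \<open>G\<close>.\<close>

lemma index_kron_one_conj:
  assumes G: "G \<in> carrier_mat b a" and X: "X \<in> carrier_mat (k * a) (k * a)"
    and i: "i < k * b" and j: "j < k * b"
  shows "(kron_mat (1\<^sub>m k) G * X * mat_adjoint (kron_mat (1\<^sub>m k) G)) $$ (i, j) =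
    (G * block a X (i div b) (j div b) * mat_adjoint G) $$ (i mod b, j mod b)"
proof -
  define K where "K = kron_mat (1\<^sub>m k) G"
  note ib = lex_div_mod[OF i] and jb = lex_div_mod[OF j]
  have K: "K $$ (i', c * a + s) = (if c = i' div b then G $$ (i' mod b, s) else 0)"
    if "i' < k * b" "c < k" "s < a" for i' c s
    unfolding K_def using index_kron_one[OF G that(1) lex_index(1)[OF that(2,3)]] lex_index(2,3)[OF that(2,3)]
    by auto
  have "(K * X * mat_adjoint K) $$ (i, j) =
      (\<Sum>s<k * a. \<Sum>t<k * a. K $$ (i, s) * X $$ (s, t) * cnj (K $$ (j, t)))"
    using G by (intro index_conj_mat[OF _ X i j]) (simp add: K_def)
  also have "\<dots> = (\<Sum>c<k. \<Sum>s<a. \<Sum>c'<k. \<Sum>t<a.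
      K $$ (i, c * a + s) * X $$ (c * a + s, c' * a + t) * cnj (K $$ (j, c' * a + t)))"
    by (simp add: sum_lessThan_mult)
  also have "\<dots> = (\<Sum>c<k. \<Sum>s<a. if c = i div b then \<Sum>c'<k. \<Sum>t<a. if c' = j div b then
      G $$ (i mod b, s) * X $$ (c * a + s, c' * a + t) * cnj (G $$ (j mod b, t)) else 0 else 0)"
    using i j by (intro sum.cong refl) (auto simp: K intro!: sum.cong)
  also have "\<dots> = (\<Sum>s<a. \<Sum>t<a.
      G $$ (i mod b, s) * X $$ (i div b * a + s, j div b * a + t) * cnj (G $$ (j mod b, t)))"
    using ib jb by (simp add: sum_sum_delta)
  also have "\<dots> = (G * block a X (i div b) (j div b) * mat_adjoint G) $$ (i mod b, j mod b)"
    using ib jb by (subst index_conj_mat[OF G]) (auto simp: block_def)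
  finally show ?thesis by (simp add: K_def)
qed

lemma block_carrier [simp]: "block a X s t \<in> carrier_mat a a"
  by (simp add: block_def)

text \<open>The link between (a) and (b): a map with Kraus operators \<open>1 (x) G l\<close> is the
  ampliation of the map with Kraus operators \<open>G l\<close>.\<close>

lemma kraus_map_kron_one:
  assumes "\<forall>l<r. G l \<in> carrier_mat b a" "X \<in> carrier_mat (k * a) (k * a)"
  shows "kraus_map (k * b) r (\<lambda>l. kron_mat (1\<^sub>m k) (G l)) X = ampliation k a b (kraus_map b r G) X"
  using assms by (intro eq_matI)
    (auto simp: ampliation_def kraus_map_def sum_mats_def index_kron_one_conj[of _ b a]
      lex_div_mod simp del: index_mult_mat(1))

text \<open>Complete positivity holds because every ampliation is again a sum of conjugations, each
  of which preserves positive semidefiniteness.\<close>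

lemma TPCP_kraus_map:
  assumes "kraus_family a b r G"
  shows "TPCP a b (kraus_map b r G)"
proof -
  have G: "\<forall>l<r. G l \<in> carrier_mat b a"
    using assms by (simp add: kraus_family_def)
  have "completely_positive a b (kraus_map b r G)"
    unfolding completely_positive_def
  proof (intro allI impI)
    fix k X assume X: "psd_mat (k * a) X"
    then have "X \<in> carrier_mat (k * a) (k * a)" by (simp add: psd_mat_def)
    from kraus_map_kron_one[OF G this]
    have "ampliation k a b (kraus_map b r G) X = kraus_map (k * b) r (\<lambda>l. kron_mat (1\<^sub>m k) (G l)) X"
      by simp
    then show "psd_mat (k * b) (ampliation k a b (kraus_map b r G) X)"
      using X G unfolding kraus_map_def by (auto intro!: psd_mat_sum_mats psd_mat_conj)
  qed
  with linear_map_kraus_map[OF G] trace_preserving_kraus_family_iff[OF G] assms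
  show ?thesis by (auto simp: TPCP_def)
qed

text \<open>Binary additivity extends to the full expansion in matrix units by induction on the set
  \<open>I\<close> of positions at which the entries of \<open>X\<close> are kept.\<close>

lemma linear_map_mat_expand:
  assumes T: "linear_map_mat a b T" and X: "X \<in> carrier_mat a a" and ij: "i < b" "j < b"
  shows "T X $$ (i, j) = (\<Sum>s<a. \<Sum>t<a. X $$ (s, t) * T (mat_unit a s t) $$ (i, j))"
proof -
  have car: "T Y \<in> carrier_mat b b" if "Y \<in> carrier_mat a a" for Y
    using T that by (simp add: linear_map_mat_def)
  define P where "P I = mat a a (\<lambda>st. if st \<in> I then X $$ st else 0)" for I
  have P: "P I \<in> carrier_mat a a" for I by (simp add: P_def)
  have "T (P I) $$ (i, j) = (\<Sum>st\<in>I. X $$ st * T (mat_unit a (fst st) (snd st)) $$ (i, j))"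
    if "finite I" "I \<subseteq> {..<a} \<times> {..<a}" for I
    using that
  proof (induction I rule: finite_induct)
    case empty
    \<comment> \<open>The truncation to no position is the zero matrix; being zero times itself, it
      is sent to zero by homogeneity.\<close>
    have "P {} = 0 \<cdot>\<^sub>m P {}" by (rule eq_matI) (auto simp: P_def)
    then have "T (P {}) = 0 \<cdot>\<^sub>m T (P {})" using T P by (metis linear_map_mat_def)
    then have "T (P {}) $$ (i, j) = (0 \<cdot>\<^sub>m T (P {})) $$ (i, j)" by simp
    then show ?case using car[OF P[of "{}"]] ij by simp
  next
    case (insert e I)
    obtain s t where e: "e = (s, t)" by (cases e)
    let ?E = "X $$ e \<cdot>\<^sub>m mat_unit a s t"
    have E: "?E \<in> carrier_mat a a" by simp
    have "P (insert e I) = ?E + P I"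
      using insert.hyps by (intro eq_matI) (auto simp: P_def mat_unit_def e)
    then have "T (P (insert e I)) = X $$ e \<cdot>\<^sub>m T (mat_unit a s t) + T (P I)"
      using T P E mat_unit_carrier by (metis linear_map_mat_def)
    then show ?case
      using insert ij car[OF P[of I]] car[OF mat_unit_carrier[of a s t]] by (simp add: e)
  qed
  from this[of "{..<a} \<times> {..<a}"] have
    "T (P ({..<a} \<times> {..<a})) $$ (i, j) = (\<Sum>s<a. \<Sum>t<a. X $$ (s, t) * T (mat_unit a s t) $$ (i, j))"
    by (simp add: sum.cartesian_product case_prod_beta)
  moreover have "P ({..<a} \<times> {..<a}) = X" using X by (intro eq_matI) (auto simp: P_def)
  ultimately show ?thesis by simp
qed

text \<open>Choi's theorem: the Gram vectors of the Choi matrix are the vectorised Kraus operators.\<close>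

lemma TPCP_kraus_rep:
  assumes T: "TPCP a b T"
  shows "\<exists>r G. kraus_family a b r G \<and> (\<forall>X\<in>carrier_mat a a. T X = kraus_map b r G X)"
proof -
  have lin: "linear_map_mat a b T" and cp: "completely_positive a b T"
    and tr: "\<And>X. X \<in> carrier_mat a a \<Longrightarrow> trace_mat (T X) = trace_mat X"
    using T by (auto simp: TPCP_def)
  \<comment> \<open>\<open>d\<close> is the vectorised identity, the sum of the
    \<open>e_i (x) e_i\<close>. Block \<open>(s, t)\<close> of \<Omega> is the matrix unit at
    \<open>(s, t)\<close>, so the ampliation of \<open>T\<close> at \<Omega> is the Choi
    matrix.\<close>
  define d where "d i = (if i div a = i mod a then 1 else 0 :: complex)" for i
  define \<Omega> where "\<Omega> = mat (a * a) (a * a) (\<lambda>(i, j). d i * d j)"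
  have "\<Omega> = mat (a * a) (a * a) (\<lambda>(i, j). cnj (d i) * d j)"
    by (rule eq_matI) (auto simp: \<Omega>_def d_def)
  then have "psd_mat (a * a) \<Omega>" using psd_mat_rank_one[of "a * a" d] by simp
  then have "psd_mat (a * b) (ampliation a a b T \<Omega>)" (is "psd_mat _ ?C")
    using cp by (simp add: completely_positive_def)
  then have C: "?C \<in> carrier_mat (a * b) (a * b)"
    and psd: "\<And>z. z \<in> carrier_vec (a * b) \<Longrightarrow> 0 \<le> conjugate z \<bullet> (?C *\<^sub>v z)"
    by (auto simp: psd_mat_def)
  have "0 \<le> (\<Sum>i<a * b. \<Sum>j<a * b. cnj (z i) * ?C $$ (i, j) * z j)" for z
    using psd[of "vec (a * b) z"] by (simp add: cinner_form_sum[OF C])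
  then obtain w where w:
    "\<And>i j. i < a * b \<Longrightarrow> j < a * b \<Longrightarrow> ?C $$ (i, j) = (\<Sum>l<a * b. w l i * cnj (w l j))"
    using psd_kernel_gram[of "{..<a * b}" "\<lambda>i j. ?C $$ (i, j)"] by auto
  have TC: "T (mat_unit a s t) $$ (i, j) = (\<Sum>l<a * b. w l (s * b + i) * cnj (w l (t * b + j)))"
    if "s < a" "t < a" "i < b" "j < b" for s t i j
  proof -
    have "block a \<Omega> s t = mat_unit a s t"
      using that by (intro eq_matI)
        (auto simp: block_def \<Omega>_def mat_unit_def d_def lex_index[of s a] lex_index[of t a])
    then have "?C $$ (s * b + i, t * b + j) = T (mat_unit a s t) $$ (i, j)"
      using that by (simp add: ampliation_def lex_index)
    then show ?thesis using w[of "s * b + i" "t * b + j"] that by (simp add: lex_index)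
  qed
  \<comment> \<open>Gram component \<open>l\<close>, a family of length \<open>a * b\<close>, is
    folded into a matrix whose column \<open>s\<close> is its part in block
    \<open>s\<close>.\<close>
  define G where "G l = mat b a (\<lambda>(i, s). w l (s * b + i))" for l
  have G: "G l \<in> carrier_mat b a" for l by (simp add: G_def)
  have TG: "T X = kraus_map b (a * b) G X" if X: "X \<in> carrier_mat a a" for X
  proof (rule eq_matI)
    fix i j assume "i < dim_row (kraus_map b (a * b) G X)" "j < dim_col (kraus_map b (a * b) G X)"
    then have ij: "i < b" "j < b" by auto
    have "T X $$ (i, j) = (\<Sum>s<a. \<Sum>t<a. \<Sum>l<a * b. G l $$ (i, s) * X $$ (s, t) * cnj (G l $$ (j, t)))"
      unfolding linear_map_mat_expand[OF lin X ij] using ij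
      by (intro sum.cong refl) (simp add: TC G_def sum_distrib_left mult_ac)
    also have "\<dots> = (\<Sum>s<a. \<Sum>l<a * b. \<Sum>t<a. G l $$ (i, s) * X $$ (s, t) * cnj (G l $$ (j, t)))"
      by (intro sum.cong refl sum.swap)
    also have "\<dots> = (\<Sum>l<a * b. \<Sum>s<a. \<Sum>t<a. G l $$ (i, s) * X $$ (s, t) * cnj (G l $$ (j, t)))"
      by (rule sum.swap)
    also have "\<dots> = kraus_map b (a * b) G X $$ (i, j)"
      using G X ij by (simp add: index_kraus_map[of _ _ b a])
    finally show "T X $$ (i, j) = kraus_map b (a * b) G X $$ (i, j)" .
  qed (use lin X in \<open>auto simp: linear_map_mat_def\<close>)
  then have "kraus_family a b (a * b) G"
    using tr G trace_preserving_kraus_family_iff[of "a * b" G b a] by simp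
  with TG show ?thesis by blast
qed

subsection \<open>Kraus operators mapping pure states to pure states\<close>

text \<open>The operators \<open>F l\<close> stacked on top of each other form an isometry.\<close>

lemma kraus_family_cinner:
  assumes F: "kraus_family a b r F" and y: "y \<in> carrier_vec a" and z: "z \<in> carrier_vec a"
  shows "(\<Sum>l<r. conjugate (F l *\<^sub>v y) \<bullet> (F l *\<^sub>v z)) = conjugate y \<bullet> z"
proof -
  have car: "F l \<in> carrier_mat b a" if "l < r" for l
    using F that by (simp add: kraus_family_def)
  have "conjugate (F l *\<^sub>v y) \<bullet> (F l *\<^sub>v z) = conjugate y \<bullet> ((mat_adjoint (F l) * F l) *\<^sub>v z)"
    if l: "l < r" for l
    using car[OF l] y z
    by (subst cinner_mult_mat_vec[of _ b a])
      (auto simp: assoc_mult_mat_vec[of _ a b _ a] intro!: mult_mat_vec_carrier[of _ b a])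
  then have "(\<Sum>l<r. conjugate (F l *\<^sub>v y) \<bullet> (F l *\<^sub>v z)) =
      conjugate y \<bullet> (sum_mats a a r (\<lambda>l. mat_adjoint (F l) * F l) *\<^sub>v z)"
    using car y z by (subst cinner_sum_mats) (auto intro!: mult_carrier_mat[of _ a b])
  then show ?thesis using F z by (simp add: kraus_family_def)
qed

lemma col_mat_carrier [simp]: "a \<in> carrier_vec m \<Longrightarrow> col_mat a \<in> carrier_mat m 1"
  by (auto simp: col_mat_def)

lemma dim_col_mat [simp]: "dim_row (col_mat a) = dim_vec a" "dim_col (col_mat a) = 1"
  by (auto simp: col_mat_def)

abbreviation (input) outer :: "complex vec \<Rightarrow> complex vec \<Rightarrow> complex mat" where
  "outer a b \<equiv> col_mat a * mat_adjoint (col_mat b)"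

lemma index_outer:
  assumes "i < dim_vec a" "j < dim_vec b"
  shows "outer a b $$ (i, j) = a $ i * cnj (b $ j)"
  using assms by (simp add: index_mult_mat_sum[of _ "dim_vec a" 1 _ "dim_vec b"] carrier_matI del: index_mult_mat(1))
    (simp add: col_mat_def)

lemma index_kraus_map_outer:
  assumes "\<forall>l<r. F l \<in> carrier_mat b a" "y \<in> carrier_vec a" "z \<in> carrier_vec a" "i < b" "j < b"
  shows "kraus_map b r F (outer y z) $$ (i, j) = (\<Sum>l<r. (F l *\<^sub>v y) $ i * cnj ((F l *\<^sub>v z) $ j))"
proof -
  have "outer y z \<in> carrier_mat a a" using assms by auto
  then have "kraus_map b r F (outer y z) $$ (i, j) =
      (\<Sum>l<r. \<Sum>s<a. \<Sum>t<a. (F l $$ (i, s) * y $ s) * (cnj (F l $$ (j, t)) * cnj (z $ t)))"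
    using assms unfolding index_kraus_map[OF assms(1) \<open>outer y z \<in> carrier_mat a a\<close> assms(4,5)]
    by (intro sum.cong refl) (simp add: index_outer mult_ac del: index_mult_mat(1))
  also have "\<dots> = (\<Sum>l<r. (F l *\<^sub>v y) $ i * cnj ((F l *\<^sub>v z) $ j))"
    using assms
    by (intro sum.cong refl)
      (simp add: index_mult_mat_vec_sum[of _ b a] sum_product del: index_mult_mat_vec)
  finally show ?thesis .
qed

text \<open>Writing \<open>w\<^sub>l = F\<^sub>l u\<close> and \<open>c\<^sub>l = v\<^sup>* w\<^sub>l\<close>, the hypothesis gives
  \<open>\<Sum>l. \<bar>w\<^sub>l b - c\<^sub>l v b\<bar>\<^sup>2 = 0\<close> for every coordinate \<open>b\<close>.\<close>

lemma kraus_map_pure_state: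
  assumes F: "\<forall>l<r. F l \<in> carrier_mat p q" and u: "u \<in> carrier_vec q" and v: "unit_norm p v"
    and eq: "kraus_map p r F (outer u u) = outer v v"
  shows "\<exists>g. \<forall>l<r. F l *\<^sub>v u = g l \<cdot>\<^sub>v v"
proof -
  have vc: "v \<in> carrier_vec p" and vn: "(\<Sum>b<p. cnj (v $ b) * v $ b) = 1"
    using v by (auto simp: unit_norm_def cinner_sum)
  define w where "w l b = (F l *\<^sub>v u) $ b" for l b
  have W: "(\<Sum>l<r. w l b * cnj (w l c)) = v $ b * cnj (v $ c)" if "b < p" "c < p" for b c
    using index_kraus_map_outer[OF F u u that] vc that unfolding eq
    by (simp add: w_def index_outer del: index_mult_mat(1) index_mult_mat_vec)
  define g where "g l = (\<Sum>c<p. cnj (v $ c) * w l c)" for l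
  \<comment> \<open>Pairing \<open>W\<close> with \<open>v\<close> in the second index removes one
    factor, since \<open>v\<close> has norm 1; pairing once more gives \<open>gg\<close>.\<close>
  have Wg: "(\<Sum>l<r. w l b * cnj (g l)) = v $ b" if b: "b < p" for b
  proof -
    have "(\<Sum>l<r. w l b * cnj (g l)) = (\<Sum>l<r. \<Sum>c<p. v $ c * (w l b * cnj (w l c)))"
      by (intro sum.cong refl) (simp add: g_def sum_distrib_left mult_ac)
    also have "\<dots> = (\<Sum>c<p. \<Sum>l<r. v $ c * (w l b * cnj (w l c)))" by (rule sum.swap)
    also have "\<dots> = (\<Sum>c<p. v $ b * (cnj (v $ c) * v $ c))"
      using b by (intro sum.cong refl) (simp add: sum_distrib_left[symmetric] W mult_ac)
    also have "\<dots> = v $ b" by (simp add: sum_distrib_left[symmetric] vn)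
    finally show ?thesis .
  qed
  have gg: "(\<Sum>l<r. g l * cnj (g l)) = 1"
  proof -
    have g: "g l * h = (\<Sum>c<p. cnj (v $ c) * (w l c * h))" for l h
      by (simp add: g_def sum_distrib_right sum_distrib_left mult_ac)
    have "(\<Sum>l<r. g l * cnj (g l)) = (\<Sum>l<r. \<Sum>c<p. cnj (v $ c) * (w l c * cnj (g l)))"
      by (intro sum.cong refl) (simp only: g)
    also have "\<dots> = (\<Sum>c<p. \<Sum>l<r. cnj (v $ c) * (w l c * cnj (g l)))" by (rule sum.swap)
    also have "\<dots> = (\<Sum>c<p. cnj (v $ c) * v $ c)"
      by (intro sum.cong refl) (simp add: sum_distrib_left[symmetric] Wg)
    finally show ?thesis by (simp add: vn)
  qed
  have "w l b = g l * v $ b" if l: "l < r" and b: "b < p" for l b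
  proof -
    have gW: "(\<Sum>l<r. g l * cnj (w l b)) = cnj (v $ b)"
      using arg_cong[OF Wg[OF b], of cnj] by (simp add: mult.commute)
    \<comment> \<open>Each of the four terms on the right has absolute value
      \<open>v $ b * cnj (v $ b)\<close>, and their signs are plus, minus, minus, plus.\<close>
    have "(\<Sum>l<r. (w l b - g l * v $ b) * cnj (w l b - g l * v $ b)) =
        (\<Sum>l<r. w l b * cnj (w l b)) - cnj (v $ b) * (\<Sum>l<r. w l b * cnj (g l))
        - v $ b * (\<Sum>l<r. g l * cnj (w l b)) + v $ b * cnj (v $ b) * (\<Sum>l<r. g l * cnj (g l))"
      by (simp add: algebra_simps sum.distrib sum_subtractf sum_distrib_left)
    also have "\<dots> = 0" by (simp add: W Wg gW gg b)
    finally have "of_real (\<Sum>l<r. (cmod (w l b - g l * v $ b))\<^sup>2) = (0 :: complex)"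
      by (simp only: of_real_sum complex_norm_square)
    then have "(\<Sum>l<r. (cmod (w l b - g l * v $ b))\<^sup>2) = 0" by (simp only: of_real_eq_0_iff)
    then show ?thesis using l by (simp add: sum_nonneg_eq_0_iff)
  qed
  then have "\<forall>l<r. F l *\<^sub>v u = g l \<cdot>\<^sub>v v"
    using F vc by (auto simp: w_def simp del: index_mult_mat_vec intro!: eq_vecI)
  then show ?thesis by blast
qed

text \<open>The pivot of all the equivalences. The row \<open>g i\<close> plays the part of
  \<open>\<gamma> i\<close> in (d), and the Gram matrix of these rows is the \<open>C\<close> of
  (e).\<close>

definition pure_kraus :: "nat \<Rightarrow> nat \<Rightarrow> nat \<Rightarrow> (nat \<Rightarrow> complex vec) \<Rightarrow> (nat \<Rightarrow> complex vec) \<Rightarrow>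
    nat \<Rightarrow> (nat \<Rightarrow> complex mat) \<Rightarrow> (nat \<Rightarrow> nat \<Rightarrow> complex) \<Rightarrow> bool" where
  "pure_kraus n p q u v r F g \<longleftrightarrow>
     kraus_family q p r F \<and> (\<forall>i<n. \<forall>l<r. F l *\<^sub>v u i = g i l \<cdot>\<^sub>v v i)"

lemma pure_krausI:
  assumes F: "kraus_family q p r F"
    and "\<And>i. i < n \<Longrightarrow> u i \<in> carrier_vec q" "\<And>i. i < n \<Longrightarrow> unit_norm p (v i)"
    and "\<And>i. i < n \<Longrightarrow> kraus_map p r F (outer (u i) (u i)) = outer (v i) (v i)"
  shows "\<exists>g. pure_kraus n p q u v r F g"
proof -
  have Fc: "\<forall>l<r. F l \<in> carrier_mat p q" using F by (simp add: kraus_family_def)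
  have "\<exists>g. \<forall>l<r. F l *\<^sub>v u i = g l \<cdot>\<^sub>v v i" if "i < n" for i
    using kraus_map_pure_state[OF Fc assms(2,3,4)] that by blast
  then obtain g where "\<And>i. i < n \<Longrightarrow> \<forall>l<r. F l *\<^sub>v u i = g i l \<cdot>\<^sub>v v i"
    by metis
  then show ?thesis using F unfolding pure_kraus_def by blast
qed

text \<open>A Kraus family preserves inner products in total by \<open>kraus_family_cinner\<close>,
  and each summand is a multiple of the inner product of \<open>v i\<close> and
  \<open>v j\<close>.\<close>

lemma pure_kraus_gram:
  assumes K: "pure_kraus n p q u v r F g" and ij: "i < n" "j < n"
    and u: "\<And>i. i < n \<Longrightarrow> u i \<in> carrier_vec q" and v: "\<And>i. i < n \<Longrightarrow> v i \<in> carrier_vec p"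
  shows "conjugate (u i) \<bullet> u j = (\<Sum>l<r. cnj (g i l) * g j l) * (conjugate (v i) \<bullet> v j)"
proof -
  have F: "kraus_family q p r F" and Fu: "\<And>i l. i < n \<Longrightarrow> l < r \<Longrightarrow> F l *\<^sub>v u i = g i l \<cdot>\<^sub>v v i"
    using K by (auto simp: pure_kraus_def)
  have "conjugate (u i) \<bullet> u j = (\<Sum>l<r. conjugate (F l *\<^sub>v u i) \<bullet> (F l *\<^sub>v u j))"
    using kraus_family_cinner[OF F] u ij by simp
  also have "\<dots> = (\<Sum>l<r. cnj (g i l) * g j l * (conjugate (v i) \<bullet> v j))"
    using ij v[OF ij(1)] v[OF ij(2)]
    by (intro sum.cong refl) (simp add: Fu cinner_sum[of _ p] sum_distrib_left mult_ac)
  finally show ?thesis by (simp add: sum_distrib_right)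
qed

text \<open>The conjugate falls on the second index here, so the coefficient is the
  \<open>(j, i)\<close> entry of the Gram matrix appearing in
  \<open>pure_kraus_gram\<close>.\<close>

lemma pure_kraus_map_outer:
  assumes K: "pure_kraus n p q u v r F g" and ij: "i < n" "j < n"
    and u: "\<And>i. i < n \<Longrightarrow> u i \<in> carrier_vec q" and v: "\<And>i. i < n \<Longrightarrow> v i \<in> carrier_vec p"
  shows "kraus_map p r F (outer (u i) (u j)) = (\<Sum>l<r. g i l * cnj (g j l)) \<cdot>\<^sub>m outer (v i) (v j)"
proof (rule eq_matI)
  have F: "\<forall>l<r. F l \<in> carrier_mat p q" and Fu: "\<And>i l. i < n \<Longrightarrow> l < r \<Longrightarrow> F l *\<^sub>v u i = g i l \<cdot>\<^sub>v v i"
    using K by (auto simp: pure_kraus_def kraus_family_def)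
  have vd: "dim_vec (v i) = p" "dim_vec (v j) = p" using v ij by auto
  fix a b assume "a < dim_row ((\<Sum>l<r. g i l * cnj (g j l)) \<cdot>\<^sub>m outer (v i) (v j))"
    "b < dim_col ((\<Sum>l<r. g i l * cnj (g j l)) \<cdot>\<^sub>m outer (v i) (v j))"
  then have ab: "a < p" "b < p" using vd by auto
  show "kraus_map p r F (outer (u i) (u j)) $$ (a, b) =
      ((\<Sum>l<r. g i l * cnj (g j l)) \<cdot>\<^sub>m outer (v i) (v j)) $$ (a, b)"
    unfolding index_kraus_map_outer[OF F u[OF ij(1)] u[OF ij(2)] ab]
    using ij vd ab
    by (simp add: Fu index_outer sum_distrib_left sum_distrib_right mult_ac del: index_mult_mat(1) index_mult_mat_vec)
qed (use v[OF ij(1)] v[OF ij(2)] in auto)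

text \<open>In \<open>a b^t\<close> times the adjoint of \<open>a' b'^t\<close> the inner factors
  collapse to the scalar \<open>b'^* b\<close>. With \<open>(a, b) = (u, v)\<close> this evaluates
  the products of the \<open>R i\<close>, with the roles exchanged those of the
  \<open>S i\<close>.\<close>

lemma rank_one_mult_adjoint:
  fixes a b a' b' :: "complex vec" and c c' :: complex
  assumes "a \<in> carrier_vec q" "b \<in> carrier_vec p" "a' \<in> carrier_vec q" "b' \<in> carrier_vec p"
  shows "(c \<cdot>\<^sub>m (col_mat a * transpose_mat (col_mat b))) *
      mat_adjoint (c' \<cdot>\<^sub>m (col_mat a' * transpose_mat (col_mat b'))) =
    (c * cnj c' * (conjugate b' \<bullet> b)) \<cdot>\<^sub>m outer a a'" (is "?A * mat_adjoint ?B = ?C")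
proof (rule eq_matI)
  have A: "?A \<in> carrier_mat q p" and B: "?B \<in> carrier_mat q p" using assms by auto
  have idx: "(k \<cdot>\<^sub>m (col_mat x * transpose_mat (col_mat y))) $$ (i, j) = k * (x $ i * y $ j)"
    if "x \<in> carrier_vec q" "y \<in> carrier_vec p" "i < q" "j < p" for k x y i j
    using that by (simp add: col_mat_def scalar_prod_def)
  fix i j assume "i < dim_row ?C" "j < dim_col ?C"
  then have ij: "i < q" "j < q" using assms by auto
  have "(?A * mat_adjoint ?B) $$ (i, j) = (\<Sum>s<p. ?A $$ (i, s) * mat_adjoint ?B $$ (s, j))"
    using A B ij by (intro index_mult_mat_sum[of _ q p _ q]) auto
  also have "\<dots> = (\<Sum>s<p. (c * (a $ i * b $ s)) * cnj (c' * (a' $ j * b' $ s)))"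
    using A B assms ij by (intro sum.cong refl) (simp add: idx del: index_mult_mat(1) index_smult_mat)
  also have "\<dots> = ?C $$ (i, j)"
    using assms ij
    by (simp add: index_outer cinner_sum[of _ p] sum_distrib_left sum_distrib_right mult_ac del: index_mult_mat(1))
  finally show "(?A * mat_adjoint ?B) $$ (i, j) = ?C $$ (i, j)" .
qed (use assms in auto)

lemma block_ampliation:
  assumes "s < k" "t < k" "T (block a X s t) \<in> carrier_mat b b"
  shows "block b (ampliation k a b T X) s t = T (block a X s t)"
  using assms by (intro eq_matI) (auto simp: block_def[of b] ampliation_def lex_index[of s k] lex_index[of t k])

lemma eq_mat_blockI:
  assumes "X \<in> carrier_mat (k * b) (k * b)" "Y \<in> carrier_mat (k * b) (k * b)"
    and "\<And>s t. s < k \<Longrightarrow> t < k \<Longrightarrow> block b X s t = block b Y s t"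
  shows "X = Y"
proof (rule eq_matI)
  fix i j assume "i < dim_row Y" "j < dim_col Y"
  then have i: "i < k * b" and j: "j < k * b" using assms by auto
  have "block b X (i div b) (j div b) $$ (i mod b, j mod b) = block b Y (i div b) (j div b) $$ (i mod b, j mod b)"
    using assms(3) lex_div_mod[OF i] lex_div_mod[OF j] by simp
  then show "X $$ (i, j) = Y $$ (i, j)"
    using lex_div_mod[OF i] lex_div_mod[OF j] by (simp add: block_def)
qed (use assms in auto)

lemma trace_block_sum:
  assumes "X \<in> carrier_mat (k * b) (k * b)"
  shows "trace_mat X = (\<Sum>s<k. trace_mat (block b X s s))"
  using assms by (simp add: trace_mat_def sum_lessThan_mult block_def)

text \<open>Both sides are read as trace preservation, because the trace of a block matrix is the
  sum of the traces of its diagonal blocks.\<close>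

lemma kraus_family_kron_one_iff:
  assumes G: "\<forall>l<r. G l \<in> carrier_mat b a" and k: "k \<ge> 1"
  shows "kraus_family (k * a) (k * b) r (\<lambda>l. kron_mat (1\<^sub>m k) (G l)) \<longleftrightarrow> kraus_family a b r G"
proof -
  let ?K = "\<lambda>l. kron_mat (1\<^sub>m k) (G l)"
  have K: "\<forall>l<r. ?K l \<in> carrier_mat (k * b) (k * a)" using G by simp
  have tr: "trace_mat (kraus_map (k * b) r ?K X) = (\<Sum>s<k. trace_mat (kraus_map b r G (block a X s s)))"
    if "X \<in> carrier_mat (k * a) (k * a)" for X
    by (subst trace_block_sum[of _ k b])
      (simp_all add: kraus_map_kron_one[OF G that] block_ampliation, simp add: ampliation_def)
  show ?thesis
  proof
    assume "kraus_family a b r G"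
    then have *: "\<And>X. X \<in> carrier_mat a a \<Longrightarrow> trace_mat (kraus_map b r G X) = trace_mat X"
      using trace_preserving_kraus_family_iff[OF G] by simp
    show "kraus_family (k * a) (k * b) r ?K"
      unfolding trace_preserving_kraus_family_iff[OF K, symmetric]
      by (auto simp: tr * trace_block_sum[of _ k a])
  next
    assume "kraus_family (k * a) (k * b) r ?K"
    then have *: "\<And>X. X \<in> carrier_mat (k * a) (k * a) \<Longrightarrow> trace_mat (kraus_map (k * b) r ?K X) = trace_mat X"
      using trace_preserving_kraus_family_iff[OF K] by simp
    show "kraus_family a b r G"
      unfolding trace_preserving_kraus_family_iff[OF G, symmetric]
    proof
      fix Y :: "complex mat" assume Y: "Y \<in> carrier_mat a a"
      \<comment> \<open>\<open>1 (x) Y\<close> has \<open>Y\<close> in each of its \<open>k\<close>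
        diagonal blocks, so both traces are \<open>k\<close> times those for \<open>Y\<close>, and
        \<open>k \<ge> 1\<close> allows cancelling.\<close>
      have KY: "kron_mat (1\<^sub>m k) Y \<in> carrier_mat (k * a) (k * a)" using Y by simp
      have "block a (kron_mat (1\<^sub>m k) Y) s s = Y" if "s < k" for s
        using Y that by (intro eq_matI) (auto simp: block_def index_kron_one[OF Y] lex_index)
      then have "of_nat k * trace_mat (kraus_map b r G Y) = of_nat k * trace_mat Y"
        using *[OF KY] unfolding tr[OF KY] trace_block_sum[OF KY] by simp
      then show "trace_mat (kraus_map b r G Y) = trace_mat Y" using k by simp
    qed
  qed
qed

section \<open>Blocks of the partial traces\<close>

lemma lex3_less:
  assumes "i < n" "j < p" "k < q"
  shows "lex3 p q i j k < n * p * q"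
  unfolding lex3_def using assms lex_index(1) by auto

text \<open>Tracing out the second factor contracts the row indices of \<open>S i\<close> and
  \<open>S j\<close>; hence the transposes, which are \<open>R i\<close> and \<open>R j\<close> in
  the theorem.\<close>

lemma block_ptrace2:
  assumes x: "x \<in> carrier_vec (n * p * q)" and ij: "i < n" "j < n"
  defines "S \<equiv> \<lambda>i. mat p q (\<lambda>(j, k). x $ lex3 p q i j k)"
  shows "block q (ptrace2 n p q (outer x x)) i j = transpose_mat (S i) * mat_adjoint (transpose_mat (S j))"
proof (rule eq_matI)
  have S: "S i \<in> carrier_mat p q" for i by (simp add: S_def)
  fix k l assume "k < dim_row (transpose_mat (S i) * mat_adjoint (transpose_mat (S j)))"
    "l < dim_col (transpose_mat (S i) * mat_adjoint (transpose_mat (S j)))"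
  then have kl: "k < q" "l < q" by (auto simp: S_def)
  have "(transpose_mat (S i) * mat_adjoint (transpose_mat (S j))) $$ (k, l) =
      (\<Sum>m<p. transpose_mat (S i) $$ (k, m) * mat_adjoint (transpose_mat (S j)) $$ (m, l))"
    using S kl by (intro index_mult_mat_sum[of _ q p _ q]) auto
  also have "\<dots> = (\<Sum>m<p. outer x x $$ (lex3 p q i m k, lex3 p q j m l))"
    using x ij kl by (intro sum.cong refl) (simp add: S_def index_outer lex3_less del: index_mult_mat(1))
  also have "\<dots> = block q (ptrace2 n p q (outer x x)) i j $$ (k, l)"
    using kl ij by (simp add: block_def ptrace2_def lex_index del: index_mult_mat(1))
  finally show "block q (ptrace2 n p q (outer x x)) i j $$ (k, l) =
      (transpose_mat (S i) * mat_adjoint (transpose_mat (S j))) $$ (k, l)" by simp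
qed (simp_all add: block_def S_def)

text \<open>Tracing out the third factor contracts the column indices, so no transpose
  appears.\<close>

lemma block_ptrace3:
  assumes x: "x \<in> carrier_vec (n * p * q)" and ij: "i < n" "j < n"
  defines "S \<equiv> \<lambda>i. mat p q (\<lambda>(j, k). x $ lex3 p q i j k)"
  shows "block p (ptrace3 n p q (outer x x)) i j = S i * mat_adjoint (S j)"
proof (rule eq_matI)
  have S: "S i \<in> carrier_mat p q" for i by (simp add: S_def)
  fix k l assume "k < dim_row (S i * mat_adjoint (S j))" "l < dim_col (S i * mat_adjoint (S j))"
  then have kl: "k < p" "l < p" by (auto simp: S_def)
  have "(S i * mat_adjoint (S j)) $$ (k, l) = (\<Sum>m<q. S i $$ (k, m) * mat_adjoint (S j) $$ (m, l))"
    using S kl by (intro index_mult_mat_sum[of _ p q _ p]) auto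
  also have "\<dots> = (\<Sum>m<q. outer x x $$ (lex3 p q i k m, lex3 p q j l m))"
    using x ij kl by (intro sum.cong refl) (simp add: S_def index_outer lex3_less del: index_mult_mat(1))
  also have "\<dots> = block p (ptrace3 n p q (outer x x)) i j $$ (k, l)"
    using kl ij by (simp add: block_def ptrace3_def lex_index del: index_mult_mat(1))
  finally show "block p (ptrace3 n p q (outer x x)) i j $$ (k, l) = (S i * mat_adjoint (S j)) $$ (k, l)"
    by simp
qed (simp_all add: block_def S_def)

subsection \<open>Correlation matrices, unitaries and block rows\<close>

lemma smult_smult_mat: "(a :: 'a :: semigroup_mult) \<cdot>\<^sub>m (b \<cdot>\<^sub>m A) = (a * b) \<cdot>\<^sub>m A"
  by (rule eq_matI) (auto simp: mult.assoc)

lemma one_smult_mat: "(1 :: 'a :: monoid_mult) \<cdot>\<^sub>m A = A"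
  by (rule eq_matI) auto

lemma mult_mat_of_cols_eq_iff:
  fixes U :: "complex mat"
  assumes U: "U \<in> carrier_mat m m"
    and a: "\<And>i. i < n \<Longrightarrow> a i \<in> carrier_vec m" and b: "\<And>i. i < n \<Longrightarrow> b i \<in> carrier_vec m"
  shows "U * mat_of_cols m (map a [0..<n]) = mat_of_cols m (map b [0..<n]) \<longleftrightarrow>
    (\<forall>i<n. U *\<^sub>v a i = b i)" (is "U * ?A = ?B \<longleftrightarrow> _")
proof -
  have A: "?A \<in> carrier_mat m n" and B: "?B \<in> carrier_mat m n"
    using mat_of_cols_carrier(1)[of m "map a [0..<n]"] mat_of_cols_carrier(1)[of m "map b [0..<n]"]
    by simp_all
  have colA: "col ?A i = a i" if "i < n" for i using a that by simp
  have colB: "col ?B i = b i" if "i < n" for i using b that by simp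
  have colU: "col (U * ?A) i = U *\<^sub>v a i" if "i < n" for i
    using col_mult2[OF U A that] colA[OF that] by simp
  show ?thesis
  proof
    assume "U * ?A = ?B"
    then show "\<forall>i<n. U *\<^sub>v a i = b i" using colU colB by metis
  next
    assume "\<forall>i<n. U *\<^sub>v a i = b i"
    then show "U * ?A = ?B"
      using U A B colU colB by (intro mat_col_eqI) auto
  qed
qed

text \<open>\<open>C\<close> is the Gram matrix of the rows of \<open>g\<close>: a sum of rank-one
  positive matrices, with unit diagonal because \<open>u i\<close> and \<open>v i\<close> have norm
  1.\<close>

lemma correlation_of_pure_kraus:
  assumes K: "pure_kraus n p q u v r F g"
    and u: "\<And>i. i < n \<Longrightarrow> unit_norm q (u i)" and v: "\<And>i. i < n \<Longrightarrow> unit_norm p (v i)"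
  shows "\<exists>C. correlation_mat n C \<and>
    mat n n (\<lambda>(i, j). conjugate (u i) \<bullet> u j) = schur_prod (mat n n (\<lambda>(i, j). conjugate (v i) \<bullet> v j)) C"
proof -
  have uc: "u i \<in> carrier_vec q" and vc: "v i \<in> carrier_vec p" if "i < n" for i
    using u v that by (auto simp: unit_norm_def)
  note gram = pure_kraus_gram[OF K _ _ uc vc]
  define C where "C = sum_mats n n r (\<lambda>l. mat n n (\<lambda>(i, j). cnj (g i l) * g j l))"
  have C: "C $$ (i, j) = (\<Sum>l<r. cnj (g i l) * g j l)" if "i < n" "j < n" for i j
    using that by (simp add: C_def sum_mats_def)
  have "psd_mat n C" unfolding C_def by (intro psd_mat_sum_mats psd_mat_rank_one)
  moreover have "C $$ (i, i) = 1" if "i < n" for i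
    using gram[OF that that] u[OF that] v[OF that] C[OF that that] by (simp add: unit_norm_def)
  ultimately have "correlation_mat n C" by (simp add: correlation_mat_def)
  moreover have "mat n n (\<lambda>(i, j). conjugate (u i) \<bullet> u j) =
      schur_prod (mat n n (\<lambda>(i, j). conjugate (v i) \<bullet> v j)) C"
    using gram C by (intro eq_matI) (auto simp: schur_prod_def mult.commute)
  ultimately show ?thesis by blast
qed

lemma cinner_kron_vec:
  assumes "a \<in> carrier_vec r" "a' \<in> carrier_vec r" "b \<in> carrier_vec p" "b' \<in> carrier_vec p"
  shows "conjugate (kron_vec a b) \<bullet> kron_vec a' b' = (conjugate a \<bullet> a') * (conjugate b \<bullet> b')"
proof -
  have "kron_vec a b \<in> carrier_vec (r * p)" "kron_vec a' b' \<in> carrier_vec (r * p)"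
    using assms by (auto simp: kron_vec_def)
  then have "conjugate (kron_vec a b) \<bullet> kron_vec a' b' =
      (\<Sum>l<r. \<Sum>s<p. cnj (kron_vec a b $ (l * p + s)) * kron_vec a' b' $ (l * p + s))"
    by (simp add: cinner_sum[of _ "r * p"] sum_lessThan_mult)
  also have "\<dots> = (\<Sum>l<r. \<Sum>s<p. (cnj (a $ l) * a' $ l) * (cnj (b $ s) * b' $ s))"
    using assms by (intro sum.cong refl) (simp add: kron_vec_def lex_index)
  also have "\<dots> = (conjugate a \<bullet> a') * (conjugate b \<bullet> b')"
    using assms by (simp add: cinner_sum[of _ r] cinner_sum[of _ p] sum_product)
  finally show ?thesis .
qed

text \<open>With Gram vectors of \<open>C\<close> as \<open>\<gamma> i\<close>, the identity in (e)
  says that the two families in (d) have equal Gram matrices, and \<open>equal_gram_unitary\<close>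
  applies.\<close>

lemma correlation_imp_unitary:
  assumes n: "n \<ge> 1" and p: "p \<ge> 1" and C: "correlation_mat n C"
    and u: "\<And>i. i < n \<Longrightarrow> unit_norm q (u i)" and v: "\<And>i. i < n \<Longrightarrow> unit_norm p (v i)"
    and eq: "mat n n (\<lambda>(i, j). conjugate (u i) \<bullet> u j) =
      schur_prod (mat n n (\<lambda>(i, j). conjugate (v i) \<bullet> v j)) C"
  shows "\<exists>r (\<gamma> :: nat \<Rightarrow> complex vec) U. p * r \<ge> q \<and> (\<forall>i<n. unit_norm r (\<gamma> i)) \<and>
    unitary_mat (p * r) U \<and>
    U * mat_of_cols (p * r) (map (\<lambda>i. u i @\<^sub>v 0\<^sub>v (p * r - q)) [0..<n]) =
      mat_of_cols (p * r) (map (\<lambda>i. kron_vec (\<gamma> i) (v i)) [0..<n])"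
proof -
  have uc: "u i \<in> carrier_vec q" and vc: "v i \<in> carrier_vec p" if "i < n" for i
    using u v that by (auto simp: unit_norm_def)
  have Cc: "C \<in> carrier_mat n n" and C1: "\<And>i. i < n \<Longrightarrow> C $$ (i, i) = 1"
    and psd: "\<And>z. z \<in> carrier_vec n \<Longrightarrow> 0 \<le> conjugate z \<bullet> (C *\<^sub>v z)"
    using C by (auto simp: correlation_mat_def psd_mat_def)
  have "0 \<le> (\<Sum>i<n. \<Sum>j<n. cnj (z i) * C $$ (i, j) * z j)" for z
    using psd[of "vec n z"] by (simp add: cinner_form_sum[OF Cc])
  then obtain w where w: "\<And>i j. i < n \<Longrightarrow> j < n \<Longrightarrow> C $$ (i, j) = (\<Sum>l<n. w l i * cnj (w l j))"
    using psd_kernel_gram[of "{..<n}" "\<lambda>i j. C $$ (i, j)"] by auto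
  \<comment> \<open>The first \<open>n\<close> places hold the Gram vectors; the \<open>q\<close>
    further ones, filled with zeros, ensure \<open>p * r \<ge> q\<close>.\<close>
  define r where "r = n + q"
  \<comment> \<open>The conjugate is taken because \<open>psd_kernel_gram\<close> conjugates the
    second factor and the inner product the first.\<close>
  define \<gamma> where "\<gamma> i = vec r (\<lambda>l. if l < n then cnj (w l i) else 0)" for i
  have \<gamma>: "\<gamma> i \<in> carrier_vec r" for i by (simp add: \<gamma>_def)
  have \<gamma>\<gamma>: "conjugate (\<gamma> i) \<bullet> \<gamma> j = C $$ (i, j)" if "i < n" "j < n" for i j
  proof -
    have "conjugate (\<gamma> i) \<bullet> \<gamma> j = (\<Sum>l<r. if l < n then w l i * cnj (w l j) else 0)"
      unfolding cinner_sum[OF \<gamma> \<gamma>] by (intro sum.cong refl) (simp add: \<gamma>_def)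
    also have "\<dots> = (\<Sum>l<n. w l i * cnj (w l j))"
      by (rule sum.mono_neutral_cong_right) (auto simp: r_def)
    finally show ?thesis using w that by simp
  qed
  have "q \<le> r" by (simp add: r_def)
  also have "r \<le> p * r" using p by (cases p) auto
  finally have pr: "q \<le> p * r" .
  define a where "a = (\<lambda>i. u i @\<^sub>v 0\<^sub>v (p * r - q))"
  have a: "a i \<in> carrier_vec (p * r)" if "i < n" for i
    using uc[OF that] pr append_carrier_vec[of "u i" q "0\<^sub>v (p * r - q)" "p * r - q"]
    by (simp add: a_def)
  define b where "b = (\<lambda>i. kron_vec (\<gamma> i) (v i))"
  have b: "b i \<in> carrier_vec (p * r)" if "i < n" for i
    using vc[OF that] \<gamma>[of i] by (auto simp: b_def kron_vec_def mult.commute)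
  have gram: "conjugate (a i) \<bullet> a j = conjugate (b i) \<bullet> b j" if ij: "i < n" "j < n" for i j
  proof -
    have "conjugate (a i) \<bullet> a j = (\<Sum>s<p * r. if s < q then cnj (u i $ s) * u j $ s else 0)"
      unfolding cinner_sum[OF a[OF ij(1)] a[OF ij(2)]] using uc[OF ij(1)] uc[OF ij(2)] pr
      by (intro sum.cong refl) (auto simp: a_def)
    also have "\<dots> = (\<Sum>s<q. cnj (u i $ s) * u j $ s)"
      using pr by (intro sum.mono_neutral_cong_right) auto
    also have "\<dots> = conjugate (u i) \<bullet> u j" using uc ij by (simp add: cinner_sum[of _ q])
    also have "\<dots> = (conjugate (v i) \<bullet> v j) * C $$ (i, j)"
      using arg_cong[OF eq, of "\<lambda>M. M $$ (i, j)"] ij by (simp add: schur_prod_def)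
    also have "\<dots> = conjugate (b i) \<bullet> b j"
      unfolding b_def cinner_kron_vec[OF \<gamma> \<gamma> vc[OF ij(1)] vc[OF ij(2)]] by (simp add: \<gamma>\<gamma> ij)
    finally show ?thesis .
  qed
  have "\<exists>U. unitary_mat (p * r) U \<and> (\<forall>i<n. U *\<^sub>v a i = b i)"
    by (rule equal_gram_unitary) (fact a b gram)+
  then obtain U where U: "unitary_mat (p * r) U" and Ua: "\<forall>i<n. U *\<^sub>v a i = b i" by blast
  have "U \<in> carrier_mat (p * r) (p * r)" using U by (simp add: unitary_mat_def)
  with Ua a b have
    "U * mat_of_cols (p * r) (map a [0..<n]) = mat_of_cols (p * r) (map b [0..<n])"
    by (subst mult_mat_of_cols_eq_iff) auto
  moreover have "unit_norm r (\<gamma> i)" if "i < n" for i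
    using \<gamma> \<gamma>\<gamma>[OF that that] C1[OF that] by (simp add: unit_norm_def)
  ultimately show ?thesis using pr U unfolding a_def b_def by blast
qed

lemma pure_kraus_of_unitary:
  assumes pr: "p * r \<ge> q" and \<gamma>: "\<And>i. i < n \<Longrightarrow> unit_norm r (\<gamma> i)" and U: "unitary_mat (p * r) U"
    and u: "\<And>i. i < n \<Longrightarrow> u i \<in> carrier_vec q" and v: "\<And>i. i < n \<Longrightarrow> v i \<in> carrier_vec p"
    and eq: "U * mat_of_cols (p * r) (map (\<lambda>i. u i @\<^sub>v 0\<^sub>v (p * r - q)) [0..<n]) =
      mat_of_cols (p * r) (map (\<lambda>i. kron_vec (\<gamma> i) (v i)) [0..<n])"
  shows "\<exists>r F g. pure_kraus n p q u v r F g"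
proof -
  have \<gamma>c: "\<gamma> i \<in> carrier_vec r" if "i < n" for i
    using \<gamma> that by (auto simp: unit_norm_def)
  have Uc: "U \<in> carrier_mat (p * r) (p * r)" and UU: "mat_adjoint U * U = 1\<^sub>m (p * r)"
    using U by (auto simp: unitary_mat_def)
  define a where "a = (\<lambda>i. u i @\<^sub>v 0\<^sub>v (p * r - q))"
  have a: "a i \<in> carrier_vec (p * r)" if "i < n" for i
    using u[OF that] pr append_carrier_vec[of "u i" q "0\<^sub>v (p * r - q)" "p * r - q"]
    by (simp add: a_def)
  define b where "b = (\<lambda>i. kron_vec (\<gamma> i) (v i))"
  have b: "b i \<in> carrier_vec (p * r)" if "i < n" for i
    using v[OF that] \<gamma>c[OF that] by (auto simp: b_def kron_vec_def mult.commute)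
  have Ua: "U *\<^sub>v a i = b i" if "i < n" for i
    using mult_mat_of_cols_eq_iff[OF Uc, of n a b] a b eq that by (simp add: a_def b_def)
  define F where "F l = mat p q (\<lambda>(i, s). U $$ (l * p + i, s))" for l
  have F: "F l \<in> carrier_mat p q" for l by (simp add: F_def)
  have "sum_mats q q r (\<lambda>l. mat_adjoint (F l) * F l) = 1\<^sub>m q"
  proof (rule eq_matI)
    fix s t assume "s < dim_row (1\<^sub>m q)" "t < dim_col (1\<^sub>m q)"
    then have st: "s < q" "t < q" by auto
    have "sum_mats q q r (\<lambda>l. mat_adjoint (F l) * F l) $$ (s, t) = (\<Sum>l<r. (mat_adjoint (F l) * F l) $$ (s, t))"
      using st by (simp add: sum_mats_def)
    also have "\<dots> = (\<Sum>l<r. \<Sum>i<p. cnj (U $$ (l * p + i, s)) * U $$ (l * p + i, t))"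
      using st F by (intro sum.cong refl, subst index_mult_mat_sum[of _ q p _ q]) (auto simp: F_def)
    \<comment> \<open>Block index and row index together run through all rows of \<open>U\<close>,
      so this is the orthonormality of its first \<open>q\<close> columns.\<close>
    also have "\<dots> = (\<Sum>k<p * r. cnj (U $$ (k, s)) * U $$ (k, t))"
      by (simp add: sum_lessThan_mult mult.commute[of p r])
    also have "\<dots> = (mat_adjoint U * U) $$ (s, t)"
      using Uc st pr by (subst index_mult_mat_sum[of _ "p * r" "p * r" _ "p * r"]) auto
    finally show "sum_mats q q r (\<lambda>l. mat_adjoint (F l) * F l) $$ (s, t) = 1\<^sub>m q $$ (s, t)"
      using UU st pr by simp
  qed (simp_all add: sum_mats_def)
  then have "kraus_family q p r F" using F by (simp add: kraus_family_def)
  moreover have "F l *\<^sub>v u i = \<gamma> i $ l \<cdot>\<^sub>v v i" if i: "i < n" and l: "l < r" for i l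
  proof (rule eq_vecI)
    fix j assume "j < dim_vec (\<gamma> i $ l \<cdot>\<^sub>v v i)"
    then have j: "j < p" using v[OF i] by simp
    have lj: "l * p + j < p * r" using lex_index(1)[OF l j] by (simp add: mult.commute)
    have "(F l *\<^sub>v u i) $ j = (\<Sum>s<q. U $$ (l * p + j, s) * u i $ s)"
      unfolding index_mult_mat_vec_sum[OF F u[OF i] j] using j by (simp add: F_def)
    \<comment> \<open>The entries of \<open>a i\<close> from position \<open>q\<close> on are
      zero.\<close>
    also have "\<dots> = (\<Sum>s<p * r. U $$ (l * p + j, s) * a i $ s)"
      using pr u[OF i] by (intro sum.mono_neutral_cong_left) (auto simp: a_def)
    also have "\<dots> = (U *\<^sub>v a i) $ (l * p + j)"
      by (rule index_mult_mat_vec_sum[OF Uc a[OF i] lj, symmetric])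
    also have "\<dots> = (\<gamma> i $ l \<cdot>\<^sub>v v i) $ j"
      using v[OF i] \<gamma>c[OF i] lex_index[OF l j] j by (simp add: Ua[OF i] b_def kron_vec_def)
    finally show "(F l *\<^sub>v u i) $ j = (\<gamma> i $ l \<cdot>\<^sub>v v i) $ j" .
  qed (use F v[OF i] in \<open>auto simp: F_def\<close>)
  ultimately have "pure_kraus n p q u v r F (\<lambda>i l. \<gamma> i $ l)" by (simp add: pure_kraus_def)
  then show ?thesis by blast
qed

text \<open>Since \<open>F (a b^t) = (F a) b^t\<close>, every entry on either side has the factor
  \<open>c\<close>, which cancels.\<close>

lemma block_row_rank_one_eq_iff:
  fixes c :: complex
  assumes F: "\<forall>l<r. F l \<in> carrier_mat p q" and a: "a \<in> carrier_vec q" and b: "b \<in> carrier_vec p"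
    and c: "c \<noteq> 0" and W: "\<forall>l<r. W l \<in> carrier_mat 1 p"
  shows "block_row p p r (\<lambda>l. F l * (c \<cdot>\<^sub>m (col_mat a * transpose_mat (col_mat b)))) =
      c \<cdot>\<^sub>m (col_mat b * block_row 1 p r W) \<longleftrightarrow>
    (\<forall>l<r. \<forall>i<p. \<forall>j<p. (F l *\<^sub>v a) $ i * b $ j = b $ i * W l $$ (0, j))"
    (is "?A = ?B \<longleftrightarrow> ?R")
proof -
  let ?M = "c \<cdot>\<^sub>m (col_mat a * transpose_mat (col_mat b))"
  have M: "?M \<in> carrier_mat q p" using a b by auto
  have AB: "?A \<in> carrier_mat p (r * p)" "?B \<in> carrier_mat p (r * p)"
    using b by (auto simp: block_row_def)
  have Ai: "?A $$ (i, l * p + j) = c * ((F l *\<^sub>v a) $ i * b $ j)" if "l < r" "i < p" "j < p" for l i j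
  proof -
    have "?A $$ (i, l * p + j) = (F l * ?M) $$ (i, j)"
      using that by (simp add: block_row_def lex_index del: index_mult_mat(1))
    also have "\<dots> = (\<Sum>s<q. F l $$ (i, s) * ?M $$ (s, j))"
      using F M that by (intro index_mult_mat_sum[of _ p q _ p]) auto
    also have "\<dots> = (\<Sum>s<q. c * (F l $$ (i, s) * a $ s * b $ j))"
      using a b that by (intro sum.cong refl) (simp add: col_mat_def scalar_prod_def)
    also have "\<dots> = c * ((F l *\<^sub>v a) $ i * b $ j)"
      using F a that
      by (simp add: index_mult_mat_vec_sum[of _ p q] sum_distrib_left sum_distrib_right mult_ac del: index_mult_mat_vec)
    finally show ?thesis .
  qed
  have Bi: "?B $$ (i, l * p + j) = c * (b $ i * W l $$ (0, j))" if "l < r" "i < p" "j < p" for l i j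
    using b that by (simp add: block_row_def lex_index col_mat_def scalar_prod_def)
  show ?thesis
  proof
    assume "?A = ?B"
    then show ?R using Ai Bi c by (metis mult_left_cancel)
  next
    assume R: ?R
    show "?A = ?B"
    proof (rule eq_matI)
      fix i m assume "i < dim_row ?B" "m < dim_col ?B"
      then have i: "i < p" and m: "m < r * p" using AB by auto
      show "?A $$ (i, m) = ?B $$ (i, m)"
        using Ai[OF lex_div_mod(1)[OF m] i lex_div_mod(2)[OF m]]
          Bi[OF lex_div_mod(1)[OF m] i lex_div_mod(2)[OF m]] R i lex_div_mod[OF m] by simp
    qed (use AB in auto)
  qed
qed

lemma index_block_row_mult_adjoint:
  assumes "\<forall>l<r. W l \<in> carrier_mat 1 p" "\<forall>l<r. W' l \<in> carrier_mat 1 p"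
  shows "(block_row 1 p r W * mat_adjoint (block_row 1 p r W')) $$ (0, 0) =
    (\<Sum>l<r. \<Sum>j<p. W l $$ (0, j) * cnj (W' l $$ (0, j)))"
proof -
  have "(block_row 1 p r W * mat_adjoint (block_row 1 p r W')) $$ (0, 0) =
      (\<Sum>m<r * p. block_row 1 p r W $$ (0, m) * mat_adjoint (block_row 1 p r W') $$ (m, 0))"
    by (intro index_mult_mat_sum[of _ 1 _ _ 1]) (auto simp: block_row_def)
  also have "\<dots> = (\<Sum>l<r. \<Sum>j<p. W l $$ (0, j) * cnj (W' l $$ (0, j)))"
    unfolding sum_lessThan_mult by (intro sum.cong refl) (simp add: block_row_def lex_index)
  finally show ?thesis .
qed

subsection \<open>The equivalences\<close>

theorem theorem3p2:
  fixes n p q :: nat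
    and x :: "complex vec"
    and X2 X3 :: "complex mat"
    and S R :: "nat \<Rightarrow> complex mat"
    and u v :: "nat \<Rightarrow> complex vec"
    and d :: "nat \<Rightarrow> real"
  assumes "n \<ge> 1" and "p \<ge> 1" and "q \<ge> 1"
    and "x \<in> carrier_vec (n * p * q)"
    and "X2 = ptrace2 n p q (col_mat x * mat_adjoint (col_mat x))"
    and "X3 = ptrace3 n p q (col_mat x * mat_adjoint (col_mat x))"
    and "\<And>i. i < n \<Longrightarrow> S i = mat p q (\<lambda>(j, k). x $ lex3 p q i j k)"
    and "\<And>i. i < n \<Longrightarrow> R i = transpose_mat (S i)"
    and "\<And>i. i < n \<Longrightarrow> vec_space.rank q (R i) = 1"
    and "\<And>i. i < n \<Longrightarrow>
           R i = complex_of_real (d i) \<cdot>\<^sub>m (col_mat (u i) * transpose_mat (col_mat (v i)))"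
    and "\<And>i. i < n \<Longrightarrow> d i > 0"
    and "\<And>i. i < n \<Longrightarrow> unit_norm q (u i)"
    and "\<And>i. i < n \<Longrightarrow> unit_norm p (v i)"
  shows
    "let
       cond_a = (\<exists>T r F. TPCP (n * q) (n * p) T \<and>
          (\<forall>j<r. F j \<in> carrier_mat p q) \<and>
          (\<forall>X\<in>carrier_mat (n * q) (n * q).
             T X = sum_mats (n * p) (n * p) r
               (\<lambda>j. kron_mat (1\<^sub>m n) (F j) * X * mat_adjoint (kron_mat (1\<^sub>m n) (F j)))) \<and>
          T X2 = X3);
       cond_b = (\<exists>L. TPCP q p L \<and>
          (\<forall>i<n. \<forall>j<n. L (R i * mat_adjoint (R j)) = S i * mat_adjoint (S j)));
       cond_c = (\<exists>r (F :: nat \<Rightarrow> complex mat) (W :: nat \<Rightarrow> nat \<Rightarrow> complex mat).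
          (\<forall>l<r. F l \<in> carrier_mat p q) \<and>
          sum_mats q q r (\<lambda>l. mat_adjoint (F l) * F l) = 1\<^sub>m q \<and>
          (\<forall>i<n. \<forall>l<r. W i l \<in> carrier_mat 1 p) \<and>
          (\<forall>i<n. block_row p p r (\<lambda>l. F l * R i) =
             complex_of_real (d i) \<cdot>\<^sub>m (col_mat (v i) * block_row 1 p r (W i))) \<and>
          (\<forall>i<n. \<forall>j<n. block_row 1 p r (W i) * mat_adjoint (block_row 1 p r (W j)) =
             transpose_mat (col_mat (u i)) * col_mat (conjugate (u j))));
       cond_d = (\<exists>r (\<gamma> :: nat \<Rightarrow> complex vec) U. p * r \<ge> q \<and>
          (\<forall>i<n. unit_norm r (\<gamma> i)) \<and>
          unitary_mat (p * r) U \<and>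
          U * mat_of_cols (p * r) (map (\<lambda>i. u i @\<^sub>v 0\<^sub>v (p * r - q)) [0..<n]) =
            mat_of_cols (p * r) (map (\<lambda>i. kron_vec (\<gamma> i) (v i)) [0..<n]));
       cond_e = (\<exists>C. correlation_mat n C \<and>
          mat n n (\<lambda>(i, j). conjugate (u i) \<bullet> u j) =
            schur_prod (mat n n (\<lambda>(i, j). conjugate (v i) \<bullet> v j)) C);
       cond_f = (\<exists>T. TPCP q p T \<and>
          (\<forall>i<n. T (col_mat (u i) * mat_adjoint (col_mat (u i))) =
             col_mat (v i) * mat_adjoint (col_mat (v i))))
     in (cond_a \<longleftrightarrow> cond_b) \<and> (cond_b \<longleftrightarrow> cond_c) \<and> (cond_c \<longleftrightarrow> cond_d) \<and>
        (cond_d \<longleftrightarrow> cond_e) \<and> (cond_e \<longleftrightarrow> cond_f)"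
proof -
  note n = assms(1) and x = assms(4) and X2 = assms(5) and X3 = assms(6) and d = assms(11)
    and uu = assms(12) and vv = assms(13)
  have u: "u i \<in> carrier_vec q" and v: "v i \<in> carrier_vec p" if "i < n" for i
    using uu[OF that] vv[OF that] by (auto simp: unit_norm_def)
  have R: "R i = complex_of_real (d i) \<cdot>\<^sub>m (col_mat (u i) * transpose_mat (col_mat (v i)))"
    if "i < n" for i using assms(10) that .
  have S: "S i = complex_of_real (d i) \<cdot>\<^sub>m (col_mat (v i) * transpose_mat (col_mat (u i)))"
    if i: "i < n" for i
  proof -
    have "S i = transpose_mat (R i)" using assms(8)[OF i] by simp
    also have "\<dots> = complex_of_real (d i) \<cdot>\<^sub>m (col_mat (v i) * transpose_mat (col_mat (u i)))"
      unfolding R[OF i] using u[OF i] v[OF i]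
      by (intro eq_matI) (auto simp: col_mat_def scalar_prod_def)
    finally show ?thesis .
  qed
  have RR: "R i * mat_adjoint (R j) =
      (complex_of_real (d i) * complex_of_real (d j) * (conjugate (v j) \<bullet> v i)) \<cdot>\<^sub>m outer (u i) (u j)"
    and SS: "S i * mat_adjoint (S j) =
      (complex_of_real (d i) * complex_of_real (d j) * (conjugate (u j) \<bullet> u i)) \<cdot>\<^sub>m outer (v i) (v j)"
    if "i < n" "j < n" for i j
    unfolding R[OF that(1)] R[OF that(2)] S[OF that(1)] S[OF that(2)]
    using that rank_one_mult_adjoint[OF u v u v, of i i j j] rank_one_mult_adjoint[OF v u v u, of i i j j]
    by simp_all
  have RRc: "R i * mat_adjoint (R j) \<in> carrier_mat q q" if "i < n" "j < n" for i j
    unfolding RR[OF that] using u[OF that(1)] u[OF that(2)] by auto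
  have X2b: "block q X2 i j = R i * mat_adjoint (R j)"
    and X3b: "block p X3 i j = S i * mat_adjoint (S j)" if "i < n" "j < n" for i j
    using block_ptrace2[OF x that] block_ptrace3[OF x that] assms(7,8) that by (simp_all add: X2 X3)
  have X2c: "X2 \<in> carrier_mat (n * q) (n * q)" and X3c: "X3 \<in> carrier_mat (n * p) (n * p)"
    by (simp_all add: X2 X3 ptrace2_def ptrace3_def)

  have gram: "conjugate (u i) \<bullet> u j = (\<Sum>l<r. cnj (g i l) * g j l) * (conjugate (v i) \<bullet> v j)"
    if "pure_kraus n p q u v r F g" "i < n" "j < n" for r F g i j
    by (rule pure_kraus_gram[OF that]) (fact u v)+
  have map_outer: "kraus_map p r F (outer (u i) (u j)) = (\<Sum>l<r. g i l * cnj (g j l)) \<cdot>\<^sub>m outer (v i) (v j)"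
    if "pure_kraus n p q u v r F g" "i < n" "j < n" for r F g i j
    by (rule pure_kraus_map_outer[OF that]) (fact u v)+

  let ?K = "\<exists>r F g. pure_kraus n p q u v r F g"
  \<comment> \<open>As \<open>u i\<close> and \<open>v i\<close> have norm 1, the hypothesis sends
    \<open>d_i^2 u_i u_i^*\<close> to \<open>d_i^2 v_i v_i^*\<close>; dividing by
    \<open>d_i^2\<close> leaves a statement on pure states.\<close>
  have K_I: ?K if F: "kraus_family q p r F"
    and eq: "\<And>i. i < n \<Longrightarrow> kraus_map p r F (R i * mat_adjoint (R i)) = S i * mat_adjoint (S i)" for r F
  proof -
    have "kraus_map p r F (outer (u i) (u i)) = outer (v i) (v i)" if i: "i < n" for i
    proof -
      define c where "c = complex_of_real (d i) * complex_of_real (d i)"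
      have c: "c \<noteq> 0" using d[OF i] by (simp add: c_def)
      have "linear_map_mat q p (kraus_map p r F)"
        using F by (intro linear_map_kraus_map) (simp add: kraus_family_def)
      moreover have "outer (u i) (u i) \<in> carrier_mat q q" using u[OF i] by auto
      ultimately have "kraus_map p r F (c \<cdot>\<^sub>m outer (u i) (u i)) = c \<cdot>\<^sub>m kraus_map p r F (outer (u i) (u i))"
        unfolding linear_map_mat_def by blast
      moreover have "kraus_map p r F (c \<cdot>\<^sub>m outer (u i) (u i)) = c \<cdot>\<^sub>m outer (v i) (v i)"
        using eq[OF i] uu[OF i] vv[OF i] unfolding RR[OF i i] SS[OF i i] by (simp add: c_def unit_norm_def)
      ultimately have "c \<cdot>\<^sub>m kraus_map p r F (outer (u i) (u i)) = c \<cdot>\<^sub>m outer (v i) (v i)"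
        by simp
      then have "(1 / c) \<cdot>\<^sub>m (c \<cdot>\<^sub>m kraus_map p r F (outer (u i) (u i))) = (1 / c) \<cdot>\<^sub>m (c \<cdot>\<^sub>m outer (v i) (v i))"
        by (rule arg_cong)
      then show ?thesis using c by (simp add: smult_smult_mat one_smult_mat)
    qed
    then show ?K using pure_krausI[OF F, of n u v] u vv by blast
  qed
  \<comment> \<open>Both sides are multiples of \<open>v_i v_j^*\<close>, and the scalars agree by
    \<open>gram\<close> taken at \<open>(j, i)\<close>.\<close>
  have K_D: "kraus_map p r F (R i * mat_adjoint (R j)) = S i * mat_adjoint (S j)"
    if K: "pure_kraus n p q u v r F g" and ij: "i < n" "j < n" for r F g i j
  proof -
    have "linear_map_mat q p (kraus_map p r F)"
      using K by (intro linear_map_kraus_map) (simp add: pure_kraus_def kraus_family_def)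
    moreover have "outer (u i) (u j) \<in> carrier_mat q q" using u[OF ij(1)] u[OF ij(2)] by auto
    ultimately have lin: "kraus_map p r F (c \<cdot>\<^sub>m outer (u i) (u j)) = c \<cdot>\<^sub>m kraus_map p r F (outer (u i) (u j))" for c
      unfolding linear_map_mat_def by blast
    show ?thesis
      unfolding RR[OF ij] SS[OF ij] lin map_outer[OF K ij]
        gram[OF K ij(2,1)]
      by (simp add: smult_smult_mat mult_ac)
  qed

  \<comment> \<open>Condition (a): maps acting on the second tensor factor\<close>
  have a: "(\<exists>T r F. TPCP (n * q) (n * p) T \<and> (\<forall>j<r. F j \<in> carrier_mat p q) \<and>
      (\<forall>X\<in>carrier_mat (n * q) (n * q). T X = sum_mats (n * p) (n * p) r
        (\<lambda>j. kron_mat (1\<^sub>m n) (F j) * X * mat_adjoint (kron_mat (1\<^sub>m n) (F j)))) \<and> T X2 = X3) \<longleftrightarrow> ?K"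
    unfolding kraus_map_def[symmetric]
  proof
    assume "\<exists>T r F. TPCP (n * q) (n * p) T \<and> (\<forall>j<r. F j \<in> carrier_mat p q) \<and>
      (\<forall>X\<in>carrier_mat (n * q) (n * q). T X = kraus_map (n * p) r (\<lambda>j. kron_mat (1\<^sub>m n) (F j)) X) \<and> T X2 = X3"
    then obtain T r F where T: "TPCP (n * q) (n * p) T" and F: "\<forall>j<r. F j \<in> carrier_mat p q"
      and TF: "\<And>X. X \<in> carrier_mat (n * q) (n * q) \<Longrightarrow>
        T X = kraus_map (n * p) r (\<lambda>j. kron_mat (1\<^sub>m n) (F j)) X"
      and TX: "T X2 = X3" by blast
    have "kraus_family (n * q) (n * p) r (\<lambda>j. kron_mat (1\<^sub>m n) (F j))"
      using T F trace_preserving_kraus_family_iff[of r "\<lambda>j. kron_mat (1\<^sub>m n) (F j)" "n * p" "n * q"]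
      by (simp add: TPCP_def TF)
    then have "kraus_family q p r F" using kraus_family_kron_one_iff[OF F n] by simp
    moreover have "kraus_map p r F (R i * mat_adjoint (R i)) = S i * mat_adjoint (S i)" if i: "i < n" for i
    proof -
      \<comment> \<open>The map of (a) is an ampliation, so comparing diagonal blocks of
        \<open>X2\<close> and \<open>X3\<close> relates \<open>R i\<close> to
        \<open>S i\<close>.\<close>
      have "X3 = ampliation n q p (kraus_map p r F) X2"
        using TX TF[OF X2c] kraus_map_kron_one[OF F X2c] by simp
      then show ?thesis
        using block_ampliation[OF i i, of "kraus_map p r F" q X2 p, OF kraus_map_carrier] X2b[OF i i] X3b[OF i i] by simp
    qed
    ultimately show ?K by (rule K_I)
  next
    assume ?K
    then obtain r F g where K: "pure_kraus n p q u v r F g" by blast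
    let ?F = "\<lambda>j. kron_mat (1\<^sub>m n) (F j)"
    have kf: "kraus_family q p r F" and F: "\<forall>j<r. F j \<in> carrier_mat p q"
      using K by (auto simp: pure_kraus_def kraus_family_def)
    have "TPCP (n * q) (n * p) (kraus_map (n * p) r ?F)"
      using kf by (intro TPCP_kraus_map) (simp add: kraus_family_kron_one_iff[OF F n])
    moreover have "kraus_map (n * p) r ?F X2 = X3"
    proof (rule eq_mat_blockI[OF _ X3c])
      fix i j assume ij: "i < n" "j < n"
      show "block p (kraus_map (n * p) r ?F X2) i j = block p X3 i j"
        unfolding kraus_map_kron_one[OF F X2c] X3b[OF ij]
        using block_ampliation[OF ij, of "kraus_map p r F" q X2 p, OF kraus_map_carrier] X2b[OF ij] K_D[OF K ij] by simp
    qed simp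
    ultimately show "\<exists>T r F. TPCP (n * q) (n * p) T \<and> (\<forall>j<r. F j \<in> carrier_mat p q) \<and>
      (\<forall>X\<in>carrier_mat (n * q) (n * q). T X = kraus_map (n * p) r (\<lambda>j. kron_mat (1\<^sub>m n) (F j)) X) \<and> T X2 = X3"
      using F by (intro exI[of _ "kraus_map (n * p) r ?F"] exI[of _ r] exI[of _ F]) simp
  qed

  \<comment> \<open>Condition (b): the products of the coefficient matrices\<close>
  have b: "(\<exists>L. TPCP q p L \<and> (\<forall>i<n. \<forall>j<n. L (R i * mat_adjoint (R j)) = S i * mat_adjoint (S j))) \<longleftrightarrow> ?K"
  proof
    assume "\<exists>L. TPCP q p L \<and> (\<forall>i<n. \<forall>j<n. L (R i * mat_adjoint (R j)) = S i * mat_adjoint (S j))"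
    then obtain L where L: "TPCP q p L"
      and LR: "\<And>i. i < n \<Longrightarrow> L (R i * mat_adjoint (R i)) = S i * mat_adjoint (S i)" by blast
    from TPCP_kraus_rep[OF L] obtain r F where F: "kraus_family q p r F"
      and LF: "\<And>X. X \<in> carrier_mat q q \<Longrightarrow> L X = kraus_map p r F X" by blast
    show ?K by (rule K_I[OF F]) (simp add: LR LF[symmetric] RRc)
  next
    assume ?K
    then obtain r F g where K: "pure_kraus n p q u v r F g" by blast
    then have "TPCP q p (kraus_map p r F)" by (intro TPCP_kraus_map) (simp add: pure_kraus_def)
    with K_D[OF K] show "\<exists>L. TPCP q p L \<and>
      (\<forall>i<n. \<forall>j<n. L (R i * mat_adjoint (R j)) = S i * mat_adjoint (S j))" by blast
  qed

  \<comment> \<open>Condition (c): block rows\<close>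
  have c: "(\<exists>r (F :: nat \<Rightarrow> complex mat) (W :: nat \<Rightarrow> nat \<Rightarrow> complex mat).
      (\<forall>l<r. F l \<in> carrier_mat p q) \<and>
      sum_mats q q r (\<lambda>l. mat_adjoint (F l) * F l) = 1\<^sub>m q \<and>
      (\<forall>i<n. \<forall>l<r. W i l \<in> carrier_mat 1 p) \<and>
      (\<forall>i<n. block_row p p r (\<lambda>l. F l * R i) =
         complex_of_real (d i) \<cdot>\<^sub>m (col_mat (v i) * block_row 1 p r (W i))) \<and>
      (\<forall>i<n. \<forall>j<n. block_row 1 p r (W i) * mat_adjoint (block_row 1 p r (W j)) =
         transpose_mat (col_mat (u i)) * col_mat (conjugate (u j)))) \<longleftrightarrow> ?K" (is "?C \<longleftrightarrow> _")
  proof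
    assume ?C
    then obtain r and F :: "nat \<Rightarrow> complex mat" and W :: "nat \<Rightarrow> nat \<Rightarrow> complex mat" where
      F: "\<forall>l<r. F l \<in> carrier_mat p q" and I: "sum_mats q q r (\<lambda>l. mat_adjoint (F l) * F l) = 1\<^sub>m q"
      and W: "\<And>i. i < n \<Longrightarrow> \<forall>l<r. W i l \<in> carrier_mat 1 p"
      and FR: "\<And>i. i < n \<Longrightarrow> block_row p p r (\<lambda>l. F l * R i) =
         complex_of_real (d i) \<cdot>\<^sub>m (col_mat (v i) * block_row 1 p r (W i))" by blast
    \<comment> \<open>Multiplying \<open>(F l u_i) v_i^t = v_i W_il\<close> on the right by the
      conjugate of \<open>v_i\<close> shows \<open>F l u_i\<close> to be this scalar times
      \<open>v_i\<close>.\<close>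
    define g where "g i l = (\<Sum>b<p. W i l $$ (0, b) * cnj (v i $ b))" for i l
    have "F l *\<^sub>v u i = g i l \<cdot>\<^sub>v v i" if i: "i < n" and l: "l < r" for i l
    proof (rule eq_vecI)
      have Fl: "F l \<in> carrier_mat p q" using F l by simp
      have 1: "(\<Sum>b<p. cnj (v i $ b) * v i $ b) = 1"
        using vv[OF i] v[OF i] by (simp add: unit_norm_def cinner_sum[of _ p])
      have d0: "complex_of_real (d i) \<noteq> 0" using d[OF i] by simp
      show "dim_vec (F l *\<^sub>v u i) = dim_vec (g i l \<cdot>\<^sub>v v i)" using Fl v[OF i] by simp
      fix a assume "a < dim_vec (g i l \<cdot>\<^sub>v v i)"
      then have a: "a < p" using v[OF i] by simp
      have E: "(F l *\<^sub>v u i) $ a * v i $ b = v i $ a * W i l $$ (0, b)" if "b < p" for b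
        using FR[OF i] block_row_rank_one_eq_iff[OF F u[OF i] v[OF i] d0 W[OF i]] l a that
        unfolding R[OF i] by blast
      have "(F l *\<^sub>v u i) $ a = (\<Sum>b<p. ((F l *\<^sub>v u i) $ a * v i $ b) * cnj (v i $ b))"
        using arg_cong[OF 1, of "\<lambda>t. (F l *\<^sub>v u i) $ a * t"] by (simp add: sum_distrib_left mult_ac)
      also have "\<dots> = (\<Sum>b<p. v i $ a * W i l $$ (0, b) * cnj (v i $ b))"
        by (intro sum.cong refl) (simp add: E)
      also have "\<dots> = (g i l \<cdot>\<^sub>v v i) $ a"
        using a v[OF i] by (simp add: g_def sum_distrib_left sum_distrib_right mult_ac)
      finally show "(F l *\<^sub>v u i) $ a = (g i l \<cdot>\<^sub>v v i) $ a" .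
    qed
    then have "pure_kraus n p q u v r F g" using F I by (simp add: pure_kraus_def kraus_family_def)
    then show ?K by blast
  next
    assume ?K
    then obtain r F g where K: "pure_kraus n p q u v r F g" by blast
    then have F: "\<forall>l<r. F l \<in> carrier_mat p q" and I: "sum_mats q q r (\<lambda>l. mat_adjoint (F l) * F l) = 1\<^sub>m q"
      and Fu: "\<And>i l. i < n \<Longrightarrow> l < r \<Longrightarrow> F l *\<^sub>v u i = g i l \<cdot>\<^sub>v v i"
      by (auto simp: pure_kraus_def kraus_family_def)
    \<comment> \<open>With \<open>W_il = g_il v_i^t\<close>, both \<open>(F l u_i) v_i^t\<close> and
      \<open>v_i W_il\<close> equal \<open>g_il v_i v_i^t\<close>.\<close>
    define W where "W i l = mat 1 p (\<lambda>(_, b). g i l * v i $ b)" for i l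
    have W: "\<forall>l<r. W i l \<in> carrier_mat 1 p" for i by (simp add: W_def)
    have "block_row p p r (\<lambda>l. F l * R i) =
        complex_of_real (d i) \<cdot>\<^sub>m (col_mat (v i) * block_row 1 p r (W i))" if i: "i < n" for i
    proof -
      have d0: "complex_of_real (d i) \<noteq> 0" using d[OF i] by simp
      show ?thesis
        unfolding R[OF i] block_row_rank_one_eq_iff[OF F u[OF i] v[OF i] d0 W]
        using v[OF i] by (simp add: Fu[OF i] W_def del: index_mult_mat_vec)
    qed
    moreover have "block_row 1 p r (W i) * mat_adjoint (block_row 1 p r (W j)) =
        transpose_mat (col_mat (u i)) * col_mat (conjugate (u j))" (is "?L = ?R") if ij: "i < n" "j < n" for i j
    proof (rule eq_matI)
      fix a b assume "a < dim_row ?R" "b < dim_col ?R"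
      then have ab: "a = 0" "b = 0" by auto
      \<comment> \<open>The sum factors into Gram entries of \<open>g\<close> and of
        \<open>v\<close>; by \<open>gram\<close> their product is \<open>u_j^* u_i\<close>, that is,
        \<open>u_i^t\<close> times the conjugate of \<open>u_j\<close>.\<close>
      have "?L $$ (0, 0) = (\<Sum>l<r. \<Sum>b<p. (cnj (g j l) * g i l) * (cnj (v j $ b) * v i $ b))"
        unfolding index_block_row_mult_adjoint[OF W W] by (simp add: W_def mult_ac)
      also have "\<dots> = conjugate (u j) \<bullet> u i"
        unfolding gram[OF K ij(2,1)] using v[OF ij(1)] v[OF ij(2)]
        by (simp add: cinner_sum[of _ p] sum_product)
      also have "\<dots> = ?R $$ (0, 0)"
        using u[OF ij(1)] u[OF ij(2)]
        by (simp add: scalar_prod_def col_mat_def mult.commute)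
      finally show "?L $$ (a, b) = ?R $$ (a, b)" by (simp only: ab)
    qed (simp_all add: block_row_def)
    ultimately show ?C using F I W by blast
  qed

  \<comment> \<open>Condition (f): pure states\<close>
  have f: "(\<exists>T. TPCP q p T \<and> (\<forall>i<n. T (outer (u i) (u i)) = outer (v i) (v i))) \<longleftrightarrow> ?K"
  proof
    assume "\<exists>T. TPCP q p T \<and> (\<forall>i<n. T (outer (u i) (u i)) = outer (v i) (v i))"
    then obtain T where T: "TPCP q p T" and Tu: "\<And>i. i < n \<Longrightarrow> T (outer (u i) (u i)) = outer (v i) (v i)"
      by blast
    from TPCP_kraus_rep[OF T] obtain r F where F: "kraus_family q p r F"
      and TF: "\<And>X. X \<in> carrier_mat q q \<Longrightarrow> T X = kraus_map p r F X" by blast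
    have "kraus_map p r F (outer (u i) (u i)) = outer (v i) (v i)" if i: "i < n" for i
    proof -
      have "outer (u i) (u i) \<in> carrier_mat q q" using u[OF i] by auto
      from TF[OF this] Tu[OF i] show ?thesis by simp
    qed
    then show ?K using pure_krausI[OF F, of n u v] u vv by blast
  next
    assume ?K
    then obtain r F g where K: "pure_kraus n p q u v r F g" by blast
    then have "TPCP q p (kraus_map p r F)" by (intro TPCP_kraus_map) (simp add: pure_kraus_def)
    moreover have "kraus_map p r F (outer (u i) (u i)) = outer (v i) (v i)" if i: "i < n" for i
    proof -
      \<comment> \<open>The norms of \<open>u i\<close> and \<open>v i\<close> are 1, so
        \<open>gram\<close> at \<open>(i, i)\<close> makes the coefficient of
        \<open>map_outer\<close> equal to 1.\<close>
      have "(\<Sum>l<r. g i l * cnj (g i l)) = 1"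
        using gram[OF K i i] uu[OF i] vv[OF i] by (simp add: unit_norm_def mult.commute)
      then show ?thesis unfolding map_outer[OF K i i] by (simp add: one_smult_mat)
    qed
    ultimately show "\<exists>T. TPCP q p T \<and> (\<forall>i<n. T (outer (u i) (u i)) = outer (v i) (v i))" by blast
  qed

  \<comment> \<open>Conditions (d) and (e): the cycle from Kraus operators through the correlation
    matrix and the unitary back\<close>
  let ?E = "\<exists>C. correlation_mat n C \<and>
    mat n n (\<lambda>(i, j). conjugate (u i) \<bullet> u j) = schur_prod (mat n n (\<lambda>(i, j). conjugate (v i) \<bullet> v j)) C"
  let ?D = "\<exists>r (\<gamma> :: nat \<Rightarrow> complex vec) U. p * r \<ge> q \<and> (\<forall>i<n. unit_norm r (\<gamma> i)) \<and>
    unitary_mat (p * r) U \<and>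
    U * mat_of_cols (p * r) (map (\<lambda>i. u i @\<^sub>v 0\<^sub>v (p * r - q)) [0..<n]) =
      mat_of_cols (p * r) (map (\<lambda>i. kron_vec (\<gamma> i) (v i)) [0..<n])"
  have KE: ?E if ?K using that correlation_of_pure_kraus[of n p q u v] uu vv by blast
  have ED: ?D if ?E using that correlation_imp_unitary[OF n assms(2), of _ q u v] uu vv by blast
  have DK: ?K if D: ?D
  proof -
    obtain r U and \<gamma> :: "nat \<Rightarrow> complex vec" where
      *: "p * r \<ge> q" "\<And>i. i < n \<Longrightarrow> unit_norm r (\<gamma> i)" "unitary_mat (p * r) U"
        "U * mat_of_cols (p * r) (map (\<lambda>i. u i @\<^sub>v 0\<^sub>v (p * r - q)) [0..<n]) =
          mat_of_cols (p * r) (map (\<lambda>i. kron_vec (\<gamma> i) (v i)) [0..<n])"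
      using D by blast
    show ?K by (rule pure_kraus_of_unitary[of q p r n \<gamma> U u v]) (fact * u v)+
  qed
  have d': "?D \<longleftrightarrow> ?K" and e: "?E \<longleftrightarrow> ?K" using KE ED DK by blast+
  show ?thesis unfolding Let_def a b c d' e f by simp
qed

end
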